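(* Let $E\to M$ be a real vector bundle of rank $2n$ over a smooth manifold, equipped with a connection $\nabla$ and a positive definite fiberwise metric $g$, and let $J$ and $K$ be sections of $\mathcal{T}(E,g)$ with $\nabla J=0$. Let $M^{\#}$ be one of $M^{(m_1,* )}$, $M^{( *,m_{-1})}$, $M^{(m_1,m_{-1})}$, let $x\in M^{\#}$, and let $P_0,P_1,P_{-1}$ be the projection operators corresponding to the orthogonal splitting $E_x=\operatorname{Im}[J,K]\oplus\ker(J+K)\oplus\ker(J-K)$ at $x$. Suppose that there is a curve $\gamma$ in $M$ such that $\gamma(0)=x$, $\gamma(t)$ lies in $M^{\#}$ for small $t\in\mathbb{R}$, and $\gamma'(0)=v$. Then 1) for $M^{\#}=M^{(m_{1},* )}$, $P_{1}(\nabla_{v}K)P_{1}=0$; 2) for $M^{\#}=M^{( *,m_{-1})}$, $P_{-1}(\nabla_{v}K)P_{-1}=0$; 3) for $M^{\#}=M^{(m_{1},m_{-1})}$, $P_{1}(\nabla_{v}K)P_{1}=0$ and $P_{-1}(\nabla_{v}K)P_{-1}=0$.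
   Context: $\mathcal{T}(E,g)=\{j\in \operatorname{End}E \mid j^2=-1,\ g(j\cdot,j\cdot)=g(\cdot,\cdot)\}$. $M^{(m_1,* )}=\{x\in M\mid\dim_{\mathbb{R}}\operatorname{Ker}(J+K)|_x=2m_1\}$, $M^{( *,m_{-1})}=\{x\in M\mid\dim_{\mathbb{R}}\operatorname{Ker}(J-K)|_x=2m_{-1}\}$, $M^{(m_1,m_{-1})}=M^{(m_1,* )}\cap M^{( *,m_{-1})}$. The connection $\nabla$ is not required to preserve $g$, and no condition is imposed on $K$ beyond being a section of $\mathcal{T}(E,g)$ or on the curvature of $\nabla$. Sections and curves are smooth. *)

theory Defs
  imports "HOL-Analysis.Analysis"
begin

section \<open>Smooth maps on open subsets of Euclidean spaces\<close>

text \<open>\<open>Ck_on k S f\<close>: \<open>f\<close> is of class \<open>C\<^sup>k\<close> on \<open>S\<close>. Only used for open \<open>S\<close>, whence the plain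
  derivative \<^term>\<open>frechet_derivative f (at x)\<close>; its continuity in \<open>x\<close> is tested on each fixed
  direction, which suffices because the domain is finite-dimensional.\<close>

primrec Ck_on :: "nat \<Rightarrow> 'a::euclidean_space set \<Rightarrow> ('a \<Rightarrow> 'b::real_normed_vector) \<Rightarrow> bool" where
  "Ck_on 0 S f \<longleftrightarrow> continuous_on S f"
| "Ck_on (Suc k) S f \<longleftrightarrow> (\<forall>x\<in>S. f differentiable at x) \<and>
     (\<forall>h. Ck_on k S (\<lambda>x. frechet_derivative f (at x) h))"

definition smooth_on :: "'a::euclidean_space set \<Rightarrow> ('a \<Rightarrow> 'b::real_normed_vector) \<Rightarrow> bool" where
  "smooth_on S f \<longleftrightarrow> (\<forall>k. Ck_on k S f)"


section \<open>Smooth manifolds\<close>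

text \<open>The underlying topological space of the manifold is the type \<open>'m\<close>. A chart is a pair
  \<open>(U, \<phi>)\<close>; the values of \<open>\<phi>\<close> outside \<open>U\<close> are irrelevant. The atlas need not be maximal.\<close>

locale smooth_manifold =
  fixes A :: "('m::{t2_space, second_countable_topology} set \<times> ('m \<Rightarrow> 'k::euclidean_space)) set"
  assumes chart: "(U, \<phi>) \<in> A \<Longrightarrow> open U \<and> open (\<phi> ` U) \<and> (\<exists>\<psi>. homeomorphism U (\<phi> ` U) \<phi> \<psi>)"
    and charts_cover: "\<exists>(U, \<phi>)\<in>A. x \<in> U"
    and charts_compatible:
      "(U, \<phi>) \<in> A \<Longrightarrow> (V, \<psi>) \<in> A \<Longrightarrow> smooth_on (\<phi> ` (U \<inter> V)) (\<psi> \<circ> inv_into U \<phi>)"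

definition smooth_map_on ::
  "('m::{t2_space, second_countable_topology} set \<times> ('m \<Rightarrow> 'k::euclidean_space)) set
    \<Rightarrow> 'm set \<Rightarrow> ('m \<Rightarrow> 'b::real_normed_vector) \<Rightarrow> bool" where
  "smooth_map_on A W f \<longleftrightarrow> (\<forall>(U, \<phi>)\<in>A. smooth_on (\<phi> ` (U \<inter> W)) (f \<circ> inv_into U \<phi>))"

definition smooth_functions ::
  "('m::{t2_space, second_countable_topology} set \<times> ('m \<Rightarrow> 'k::euclidean_space)) set
    \<Rightarrow> ('m \<Rightarrow> real) set" where
  "smooth_functions A = {f. smooth_map_on A UNIV f}"

text \<open>Tangent vectors at \<open>x\<close> are the derivations at \<open>x\<close> of the algebra of smooth functions.
  A derivation is set to \<open>0\<close> off that algebra so that it is determined by its values on it.\<close>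

definition tangent_space ::
  "('m::{t2_space, second_countable_topology} set \<times> ('m \<Rightarrow> 'k::euclidean_space)) set
    \<Rightarrow> 'm \<Rightarrow> (('m \<Rightarrow> real) \<Rightarrow> real) set" where
  "tangent_space A x = {v.
     (\<forall>f. f \<notin> smooth_functions A \<longrightarrow> v f = 0) \<and>
     (\<forall>f\<in>smooth_functions A. \<forall>h\<in>smooth_functions A. v (\<lambda>y. f y + h y) = v f + v h) \<and>
     (\<forall>c. \<forall>f\<in>smooth_functions A. v (\<lambda>y. c * f y) = c * v f) \<and>
     (\<forall>f\<in>smooth_functions A. \<forall>h\<in>smooth_functions A.
        v (\<lambda>y. f y * h y) = v f * h x + f x * v h)}"

definition smooth_vector_field ::
  "('m::{t2_space, second_countable_topology} set \<times> ('m \<Rightarrow> 'k::euclidean_space)) set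
    \<Rightarrow> ('m \<Rightarrow> ('m \<Rightarrow> real) \<Rightarrow> real) \<Rightarrow> bool" where
  "smooth_vector_field A X \<longleftrightarrow> (\<forall>x. X x \<in> tangent_space A x) \<and>
     (\<forall>f\<in>smooth_functions A. (\<lambda>x. X x f) \<in> smooth_functions A)"

definition smooth_curve_on ::
  "('m::{t2_space, second_countable_topology} set \<times> ('m \<Rightarrow> 'k::euclidean_space)) set
    \<Rightarrow> real set \<Rightarrow> (real \<Rightarrow> 'm) \<Rightarrow> bool" where
  "smooth_curve_on A I \<gamma> \<longleftrightarrow> continuous_on I \<gamma> \<and>
     (\<forall>(U, \<phi>)\<in>A. smooth_on {t\<in>I. \<gamma> t \<in> U} (\<phi> \<circ> \<gamma>))"

definition velocity ::
  "('m::{t2_space, second_countable_topology} set \<times> ('m \<Rightarrow> 'k::euclidean_space)) set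
    \<Rightarrow> (real \<Rightarrow> 'm) \<Rightarrow> real \<Rightarrow> ('m \<Rightarrow> real) \<Rightarrow> real" where
  "velocity A \<gamma> t f = (if f \<in> smooth_functions A then deriv (f \<circ> \<gamma>) t else 0)"


section \<open>Vector bundles, metrics and connections\<close>

definition linear_map_on ::
  "'a::real_vector set \<Rightarrow> 'b::real_vector set \<Rightarrow> ('a \<Rightarrow> 'b) \<Rightarrow> bool" where
  "linear_map_on V W f \<longleftrightarrow> f ` V \<subseteq> W \<and> (\<forall>a\<in>V. \<forall>b\<in>V. f (a + b) = f a + f b) \<and>
     (\<forall>c. \<forall>a\<in>V. f (c *\<^sub>R a) = c *\<^sub>R f a)"

text \<open>The fibres \<open>E x\<close> are subspaces of one vector space \<open>'f\<close>. This is no restriction (every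
  family of vector spaces embeds in its product), and \<open>'f\<close> only hosts the fibrewise linear
  structure: topology and smooth structure come from the local trivializations
  \<open>(U, \<tau>) \<in> \<Phi>\<close>, where \<open>\<tau> x : E x \<rightarrow> 'r\<close> for \<open>x \<in> U\<close>. The rank is \<^term>\<open>DIM('r::euclidean_space)\<close>.\<close>

locale vector_bundle = smooth_manifold A
  for A :: "('m::{t2_space, second_countable_topology} set \<times> ('m \<Rightarrow> 'k::euclidean_space)) set" +
  fixes E :: "'m \<Rightarrow> 'f::real_vector set"
    and \<Phi> :: "('m set \<times> ('m \<Rightarrow> 'f \<Rightarrow> 'r::euclidean_space)) set"
  assumes fibre_subspace: "subspace (E x)"
    and triv_open: "(U, \<tau>) \<in> \<Phi> \<Longrightarrow> open U"
    and triv_iso: "(U, \<tau>) \<in> \<Phi> \<Longrightarrow> x \<in> U \<Longrightarrow>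
      linear_map_on (E x) UNIV (\<tau> x) \<and> bij_betw (\<tau> x) (E x) UNIV"
    and triv_cover: "\<exists>(U, \<tau>)\<in>\<Phi>. x \<in> U"
    and triv_transition: "(U, \<tau>) \<in> \<Phi> \<Longrightarrow> (V, \<sigma>) \<in> \<Phi> \<Longrightarrow>
      smooth_map_on A (U \<inter> V) (\<lambda>x. \<sigma> x (inv_into (E x) (\<tau> x) w))"

definition smooth_sections ::
  "('m::{t2_space, second_countable_topology} set \<times> ('m \<Rightarrow> 'k::euclidean_space)) set
    \<Rightarrow> ('m \<Rightarrow> 'f::real_vector set) \<Rightarrow> ('m set \<times> ('m \<Rightarrow> 'f \<Rightarrow> 'r::euclidean_space)) set
    \<Rightarrow> ('m \<Rightarrow> 'f) set" where
  "smooth_sections A E \<Phi> = {s. (\<forall>x. s x \<in> E x) \<and>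
     (\<forall>(U, \<tau>)\<in>\<Phi>. smooth_map_on A U (\<lambda>x. \<tau> x (s x)))}"

definition smooth_End_section ::
  "('m::{t2_space, second_countable_topology} set \<times> ('m \<Rightarrow> 'k::euclidean_space)) set
    \<Rightarrow> ('m \<Rightarrow> 'f::real_vector set) \<Rightarrow> ('m set \<times> ('m \<Rightarrow> 'f \<Rightarrow> 'r::euclidean_space)) set
    \<Rightarrow> ('m \<Rightarrow> 'f \<Rightarrow> 'f) \<Rightarrow> bool" where
  "smooth_End_section A E \<Phi> L \<longleftrightarrow> (\<forall>x. linear_map_on (E x) (E x) (L x)) \<and>
     (\<forall>(U, \<tau>)\<in>\<Phi>. \<forall>w. smooth_map_on A U (\<lambda>x. \<tau> x (L x (inv_into (E x) (\<tau> x) w))))"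

locale bundle_metric = vector_bundle A E \<Phi>
  for A :: "('m::{t2_space, second_countable_topology} set \<times> ('m \<Rightarrow> 'k::euclidean_space)) set"
    and E :: "'m \<Rightarrow> 'f::real_vector set"
    and \<Phi> :: "('m set \<times> ('m \<Rightarrow> 'f \<Rightarrow> 'r::euclidean_space)) set" +
  fixes g :: "'m \<Rightarrow> 'f \<Rightarrow> 'f \<Rightarrow> real"
  assumes metric_linear: "a \<in> E x \<Longrightarrow> linear_map_on (E x) UNIV (g x a)"
    and metric_sym: "a \<in> E x \<Longrightarrow> b \<in> E x \<Longrightarrow> g x a b = g x b a"
    and metric_pos: "a \<in> E x \<Longrightarrow> a \<noteq> 0 \<Longrightarrow> g x a a > 0"
    and metric_smooth: "(U, \<tau>) \<in> \<Phi> \<Longrightarrow>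
      smooth_map_on A U (\<lambda>x. g x (inv_into (E x) (\<tau> x) w) (inv_into (E x) (\<tau> x) w'))"

text \<open>\<open>nabla x v s\<close> is \<open>\<nabla>\<^sub>v s\<close> for \<open>v\<close> tangent at \<open>x\<close> and a global smooth section \<open>s\<close>.
  Homogeneity over the reals in \<open>s\<close> is the Leibniz rule for constant functions.\<close>

locale bundle_connection = vector_bundle A E \<Phi>
  for A :: "('m::{t2_space, second_countable_topology} set \<times> ('m \<Rightarrow> 'k::euclidean_space)) set"
    and E :: "'m \<Rightarrow> 'f::real_vector set"
    and \<Phi> :: "('m set \<times> ('m \<Rightarrow> 'f \<Rightarrow> 'r::euclidean_space)) set" +
  fixes nabla :: "'m \<Rightarrow> (('m \<Rightarrow> real) \<Rightarrow> real) \<Rightarrow> ('m \<Rightarrow> 'f) \<Rightarrow> 'f"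
  assumes nabla_fibre: "v \<in> tangent_space A x \<Longrightarrow> s \<in> smooth_sections A E \<Phi> \<Longrightarrow>
      nabla x v s \<in> E x"
    and nabla_linear: "v \<in> tangent_space A x \<Longrightarrow> w \<in> tangent_space A x \<Longrightarrow>
      s \<in> smooth_sections A E \<Phi> \<Longrightarrow>
      nabla x (\<lambda>f. a * v f + b * w f) s = a *\<^sub>R nabla x v s + b *\<^sub>R nabla x w s"
    and nabla_add: "v \<in> tangent_space A x \<Longrightarrow> s \<in> smooth_sections A E \<Phi> \<Longrightarrow>
      s' \<in> smooth_sections A E \<Phi> \<Longrightarrow>
      nabla x v (\<lambda>y. s y + s' y) = nabla x v s + nabla x v s'"
    and nabla_Leibniz: "v \<in> tangent_space A x \<Longrightarrow> f \<in> smooth_functions A \<Longrightarrow>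
      s \<in> smooth_sections A E \<Phi> \<Longrightarrow>
      nabla x v (\<lambda>y. f y *\<^sub>R s y) = v f *\<^sub>R s x + f x *\<^sub>R nabla x v s"
    and nabla_smooth: "smooth_vector_field A X \<Longrightarrow> s \<in> smooth_sections A E \<Phi> \<Longrightarrow>
      (\<lambda>x. nabla x (X x) s) \<in> smooth_sections A E \<Phi>"

text \<open>The induced connection on \<open>End E\<close>: \<open>(\<nabla>\<^sub>v L) s(x) = \<nabla>\<^sub>v (L s) - L (\<nabla>\<^sub>v s)\<close>, the value at
  \<open>e \<in> E x\<close> being obtained from any section \<open>s\<close> through \<open>e\<close>.\<close>

definition nabla_End ::
  "('m::{t2_space, second_countable_topology} set \<times> ('m \<Rightarrow> 'k::euclidean_space)) set
    \<Rightarrow> ('m \<Rightarrow> 'f::real_vector set) \<Rightarrow> ('m set \<times> ('m \<Rightarrow> 'f \<Rightarrow> 'r::euclidean_space)) set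
    \<Rightarrow> ('m \<Rightarrow> (('m \<Rightarrow> real) \<Rightarrow> real) \<Rightarrow> ('m \<Rightarrow> 'f) \<Rightarrow> 'f)
    \<Rightarrow> 'm \<Rightarrow> (('m \<Rightarrow> real) \<Rightarrow> real) \<Rightarrow> ('m \<Rightarrow> 'f \<Rightarrow> 'f) \<Rightarrow> 'f \<Rightarrow> 'f" where
  "nabla_End A E \<Phi> nabla x v L e =
     (THE u. \<forall>s\<in>smooth_sections A E \<Phi>. s x = e \<longrightarrow>
        u = nabla x v (\<lambda>y. L y (s y)) - L x (nabla x v s))"

definition parallel_End ::
  "('m::{t2_space, second_countable_topology} set \<times> ('m \<Rightarrow> 'k::euclidean_space)) set
    \<Rightarrow> ('m \<Rightarrow> 'f::real_vector set) \<Rightarrow> ('m set \<times> ('m \<Rightarrow> 'f \<Rightarrow> 'r::euclidean_space)) set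
    \<Rightarrow> ('m \<Rightarrow> (('m \<Rightarrow> real) \<Rightarrow> real) \<Rightarrow> ('m \<Rightarrow> 'f) \<Rightarrow> 'f) \<Rightarrow> ('m \<Rightarrow> 'f \<Rightarrow> 'f) \<Rightarrow> bool" where
  "parallel_End A E \<Phi> nabla L \<longleftrightarrow>
     (\<forall>x. \<forall>v\<in>tangent_space A x. \<forall>e\<in>E x. nabla_End A E \<Phi> nabla x v L e = 0)"


section \<open>Orthogonal complex structures on the fibres\<close>

definition orth_complex_structures ::
  "'f::real_vector set \<Rightarrow> ('f \<Rightarrow> 'f \<Rightarrow> real) \<Rightarrow> ('f \<Rightarrow> 'f) set" where
  "orth_complex_structures V h = {j. linear_map_on V V j \<and> (\<forall>a\<in>V. j (j a) = - a) \<and>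
     (\<forall>a\<in>V. \<forall>b\<in>V. h (j a) (j b) = h a b)}"

definition twistor_section ::
  "('m::{t2_space, second_countable_topology} set \<times> ('m \<Rightarrow> 'k::euclidean_space)) set
    \<Rightarrow> ('m \<Rightarrow> 'f::real_vector set) \<Rightarrow> ('m set \<times> ('m \<Rightarrow> 'f \<Rightarrow> 'r::euclidean_space)) set
    \<Rightarrow> ('m \<Rightarrow> 'f \<Rightarrow> 'f \<Rightarrow> real) \<Rightarrow> ('m \<Rightarrow> 'f \<Rightarrow> 'f) \<Rightarrow> bool" where
  "twistor_section A E \<Phi> g L \<longleftrightarrow>
     smooth_End_section A E \<Phi> L \<and> (\<forall>x. L x \<in> orth_complex_structures (E x) (g x))"

definition im_commutator :: "'f::real_vector set \<Rightarrow> ('f \<Rightarrow> 'f) \<Rightarrow> ('f \<Rightarrow> 'f) \<Rightarrow> 'f set" where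
  "im_commutator V j k = (\<lambda>e. j (k e) - k (j e)) ` V"

definition ker_sum :: "'f::real_vector set \<Rightarrow> ('f \<Rightarrow> 'f) \<Rightarrow> ('f \<Rightarrow> 'f) \<Rightarrow> 'f set" where
  "ker_sum V j k = {e\<in>V. j e + k e = 0}"

definition ker_diff :: "'f::real_vector set \<Rightarrow> ('f \<Rightarrow> 'f) \<Rightarrow> ('f \<Rightarrow> 'f) \<Rightarrow> 'f set" where
  "ker_diff V j k = {e\<in>V. j e - k e = 0}"

definition M_plus ::
  "('m \<Rightarrow> 'f::real_vector set) \<Rightarrow> ('m \<Rightarrow> 'f \<Rightarrow> 'f) \<Rightarrow> ('m \<Rightarrow> 'f \<Rightarrow> 'f) \<Rightarrow> nat \<Rightarrow> 'm set" where
  "M_plus E J K m = {x. dim (ker_sum (E x) (J x) (K x)) = 2 * m}"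

definition M_minus ::
  "('m \<Rightarrow> 'f::real_vector set) \<Rightarrow> ('m \<Rightarrow> 'f \<Rightarrow> 'f) \<Rightarrow> ('m \<Rightarrow> 'f \<Rightarrow> 'f) \<Rightarrow> nat \<Rightarrow> 'm set" where
  "M_minus E J K m = {x. dim (ker_diff (E x) (J x) (K x)) = 2 * m}"

text \<open>The three projection operators of a splitting \<open>W0 \<oplus> W1 \<oplus> W2\<close> applied to \<open>e\<close>; meaningful
  only when the sum is direct and contains \<open>e\<close>.\<close>

definition splitting_components ::
  "'f::real_vector set \<Rightarrow> 'f set \<Rightarrow> 'f set \<Rightarrow> 'f \<Rightarrow> 'f \<times> 'f \<times> 'f" where
  "splitting_components W0 W1 W2 e =
     (THE (a, b, c). a \<in> W0 \<and> b \<in> W1 \<and> c \<in> W2 \<and> e = a + b + c)"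

end

theory Submission
  imports Defs
begin

text \<open>
  Put \<open>L = J + K\<close>. Along the curve the kernel of \<open>L\<close> has constant dimension, so \<open>L\<close> has
  constant rank there. If \<open>s\<close> is a section with \<open>s x\<close> in the kernel of \<open>L\<close> at \<open>x\<close>, then \<open>L s\<close>,
  read along the curve in a trivialization, is a curve of vectors lying in the image of \<open>L\<close> and
  vanishing at \<open>0\<close>. Its derivative at \<open>0\<close> lies in the image of \<open>L\<close> at \<open>x\<close>, because otherwise
  difference quotients would supply one more independent vector in nearby images, and the rank
  would jump (\<open>derivative_in_range_of_constant_rank\<close>). As \<open>L s\<close> vanishes at \<open>x\<close>, that derivative
  is \<open>\<nabla>\<^sub>v (L s)\<close>, whatever the connection (\<open>nabla_velocity_at_zero\<close>). Hence
  \<open>(\<nabla>\<^sub>v L) (s x) = \<nabla>\<^sub>v (L s) - L (\<nabla>\<^sub>v s)\<close> lies in the image of \<open>L\<close>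
  (\<open>nabla_End_maps_kernel_to_image\<close>), and \<open>\<nabla>\<^sub>v L = \<nabla>\<^sub>v K\<close> since \<open>J\<close> is parallel.

  In each fibre \<open>J + K\<close> preserves the three summands of the splitting: it vanishes on
  \<open>ker (J + K)\<close>, maps \<open>ker (J - K)\<close> to itself as \<open>2 J\<close>, and anticommutes with \<open>[J, K]\<close>. So its
  image has no component in \<open>ker (J + K)\<close>, that is, \<open>P\<^sub>1 (\<nabla>\<^sub>v K) P\<^sub>1 = 0\<close>. The statement for
  the other projection is the same argument for \<open>L = J - K\<close>, where \<open>\<nabla>\<^sub>v L = - \<nabla>\<^sub>v K\<close>.

  Since connections act on global sections and \<open>\<nabla>\<^sub>v L\<close> is defined through sections with a
  prescribed value, local frames have to be extended by cutoff functions. This rests on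
  the calculus of \<open>C\<^sup>k\<close> maps and on a smooth bump function.
\<close>

section \<open>Calculus of maps of class \<open>C\<^sup>k\<close>\<close>

lemma Ck_on_subset: "Ck_on k S f \<Longrightarrow> T \<subseteq> S \<Longrightarrow> Ck_on k T f"
  by (induction k arbitrary: f) (auto intro: continuous_on_subset)

lemma frechet_derivative_cong_open:
  assumes "open S" "x \<in> S" "\<And>y. y \<in> S \<Longrightarrow> f y = g y"
  shows "(f has_derivative D) (at x) \<longleftrightarrow> (g has_derivative D) (at x)"
    and "frechet_derivative f (at x) = frechet_derivative g (at x)"
proof -
  show eq: "(f has_derivative D) (at x) \<longleftrightarrow> (g has_derivative D) (at x)" for D
    using assms has_derivative_transform_within_open[of f D x UNIV S g]
      has_derivative_transform_within_open[of g D x UNIV S f] by auto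
  show "frechet_derivative f (at x) = frechet_derivative g (at x)"
    by (simp add: frechet_derivative_def eq)
qed

lemma Ck_on_cong:
  assumes "open S" "\<And>x. x \<in> S \<Longrightarrow> f x = g x"
  shows "Ck_on k S f \<longleftrightarrow> Ck_on k S g"
  using assms(2)
proof (induction k arbitrary: f g)
  case 0
  then show ?case by (auto cong: continuous_on_cong)
next
  case (Suc k)
  have "f differentiable at x \<longleftrightarrow> g differentiable at x" if "x \<in> S" for x
    unfolding differentiable_def
    using frechet_derivative_cong_open(1)[OF assms(1) that, of f g] Suc.prems by simp
  moreover have "Ck_on k S (\<lambda>x. frechet_derivative f (at x) h) \<longleftrightarrow>
      Ck_on k S (\<lambda>x. frechet_derivative g (at x) h)" for h
    using frechet_derivative_cong_open(2)[OF assms(1) _ Suc.prems] by (intro Suc.IH) simp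
  ultimately show ?case by simp
qed

lemma Ck_on_Un:
  assumes "open S" "open T" "Ck_on k S f" "Ck_on k T f"
  shows "Ck_on k (S \<union> T) f"
  using assms(3,4) by (induction k arbitrary: f) (auto intro: continuous_on_open_Un assms)

lemma Ck_on_SucD: "Ck_on (Suc k) S f \<Longrightarrow> Ck_on k S f"
proof (induction k arbitrary: f)
  case 0
  then show ?case
    by (auto intro!: continuous_at_imp_continuous_on differentiable_imp_continuous_within)
next
  case (Suc k)
  then show ?case using Ck_on.simps(2) by blast
qed

text \<open>Derivatives are unique, so a concrete candidate may replace the derivative that is chosen
  in the definition of class \<open>C\<^sup>k\<close>.\<close>

lemma Ck_on_SucI:
  assumes "open S" "\<And>x. x \<in> S \<Longrightarrow> (f has_derivative D x) (at x)"
    and "\<And>h. Ck_on k S (\<lambda>x. D x h)"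
  shows "Ck_on (Suc k) S f"
proof -
  have "Ck_on k S (\<lambda>x. frechet_derivative f (at x) h)" for h
    using assms(3)[of h] frechet_derivative_at[OF assms(2)]
    by (subst Ck_on_cong[OF assms(1), where g = "\<lambda>x. D x h"]) auto
  then show ?thesis using assms(2) by (auto simp: differentiable_def)
qed

lemma Ck_on_SucE:
  assumes "Ck_on (Suc k) S f" "x \<in> S"
  shows "(f has_derivative frechet_derivative f (at x)) (at x)"
  using assms by (simp add: frechet_derivative_works)

lemma Ck_on_const: "open S \<Longrightarrow> Ck_on k S (\<lambda>x. c)"
proof (induction k arbitrary: c)
  case (Suc k)
  show ?case by (rule Ck_on_SucI[OF Suc.prems, where D = "\<lambda>x h. 0"]) (auto intro: Suc)
qed simp

lemma Ck_on_add:
  assumes "open S" "Ck_on k S f" "Ck_on k S g"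
  shows "Ck_on k S (\<lambda>x. f x + g x)"
  using assms(2,3)
proof (induction k arbitrary: f g)
  case 0
  then show ?case by (simp add: continuous_on_add)
next
  case (Suc k)
  show ?case
    by (rule Ck_on_SucI[OF assms(1) has_derivative_add[OF Ck_on_SucE[OF Suc.prems(1)]
          Ck_on_SucE[OF Suc.prems(2)]]])
      (use Suc.IH Suc.prems in auto)
qed

lemma Ck_on_sum:
  assumes "open S" "finite B" "\<And>b. b \<in> B \<Longrightarrow> Ck_on k S (f b)"
  shows "Ck_on k S (\<lambda>x. \<Sum>b\<in>B. f b x)"
  using assms(2,3) by (induction B rule: finite_induct) (auto intro: Ck_on_const Ck_on_add assms(1))

lemma Ck_on_bounded_linear:
  assumes "open S" "Ck_on k S f" "bounded_linear l"
  shows "Ck_on k S (\<lambda>x. l (f x))"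
  using assms(2)
proof (induction k arbitrary: f)
  case 0
  then show ?case by (simp add: bounded_linear.continuous_on[OF assms(3)])
next
  case (Suc k)
  show ?case
    by (rule Ck_on_SucI[OF assms(1) bounded_linear.has_derivative[OF assms(3) Ck_on_SucE[OF Suc.prems]]])
      (use Suc.IH Suc.prems in auto)
qed

lemmas Ck_on_inner_left = Ck_on_bounded_linear[OF _ _ bounded_linear_inner_left]

lemma Ck_on_scaleR:
  fixes f :: "'a::euclidean_space \<Rightarrow> real" and g :: "'a \<Rightarrow> 'b::real_normed_vector"
  assumes "open S" "Ck_on k S f" "Ck_on k S g"
  shows "Ck_on k S (\<lambda>x. f x *\<^sub>R g x)"
  using assms(2,3)
proof (induction k arbitrary: f g)
  case 0
  then show ?case by (simp add: continuous_on_scaleR)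
next
  case (Suc k)
  show ?case
    by (rule Ck_on_SucI[OF assms(1) has_derivative_scaleR[OF Ck_on_SucE[OF Suc.prems(1)]
          Ck_on_SucE[OF Suc.prems(2)]]])
      (use Suc.prems in \<open>auto intro!: Ck_on_add assms(1) Suc.IH
          Ck_on_SucD[OF Suc.prems(1)] Ck_on_SucD[OF Suc.prems(2)]\<close>)
qed

text \<open>By the chain rule, the derivative of \<open>g \<circ> f\<close> in direction \<open>h\<close> is a sum of products of
  components of \<open>Df h\<close> with partial derivatives of \<open>g\<close> composed with \<open>f\<close>.\<close>

lemma Ck_on_compose:
  fixes f :: "'a::euclidean_space \<Rightarrow> 'b::euclidean_space" and g :: "'b \<Rightarrow> 'c::real_normed_vector"
  assumes "open S" "Ck_on k S f" "Ck_on k T g" "f ` S \<subseteq> T"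
  shows "Ck_on k S (\<lambda>x. g (f x))"
  using assms(2,3)
proof (induction k arbitrary: g)
  case 0
  then show ?case using continuous_on_compose2 assms(4) by auto
next
  case (Suc k)
  let ?Df = "\<lambda>x. frechet_derivative f (at x)" and ?Dg = "\<lambda>y. frechet_derivative g (at y)"
  have D: "((\<lambda>x. g (f x)) has_derivative (\<lambda>h. \<Sum>b\<in>Basis. (?Df x h \<bullet> b) *\<^sub>R ?Dg (f x) b)) (at x)"
    if x: "x \<in> S" for x
  proof -
    have g: "(g has_derivative ?Dg (f x)) (at (f x))"
      using Ck_on_SucE[OF Suc.prems(2)] assms(4) x by auto
    have lin: "linear (?Dg (f x))" using g by (rule has_derivative_linear)
    have eq: "?Dg (f x) w = (\<Sum>b\<in>Basis. (w \<bullet> b) *\<^sub>R ?Dg (f x) b)" for w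
      using arg_cong[OF euclidean_representation[of w], of "?Dg (f x)"]
      by (simp only: linear_sum[OF lin] linear_cmul[OF lin] comp_def)
    show ?thesis
      by (rule has_derivative_eq_rhs[OF has_derivative_compose[OF Ck_on_SucE[OF Suc.prems(1) x] g]])
        (rule ext, rule eq)
  qed
  have "Ck_on k S (\<lambda>x. \<Sum>b\<in>Basis. (?Df x h \<bullet> b) *\<^sub>R ?Dg (f x) b)" for h
  proof (intro Ck_on_sum Ck_on_scaleR assms(1) finite_Basis)
    fix b :: 'b
    show "Ck_on k S (\<lambda>x. ?Df x h \<bullet> b)"
      using Suc.prems(1) by (intro Ck_on_inner_left assms(1)) simp
    show "Ck_on k S (\<lambda>x. ?Dg (f x) b)"
      using Suc.prems by (intro Suc.IH[OF Ck_on_SucD]) auto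
  qed
  with D show ?case by (rule Ck_on_SucI[OF assms(1)])
qed

section \<open>Bump functions on Euclidean spaces\<close>

text \<open>For \<open>t > 0\<close> every derivative of \<open>exp (-1/t)\<close> is a combination of functions \<open>exp (-1/t) / t\<^sup>n\<close>.
  Treating this family for all \<open>n\<close> at once turns smoothness into a plain induction.\<close>

definition flat_exp :: "nat \<Rightarrow> real \<Rightarrow> real" where
  "flat_exp n t = (if t > 0 then exp (- inverse t) * inverse t ^ n else 0)"

lemma flat_exp_tendsto_0: "(flat_exp n \<longlongrightarrow> 0) (at 0)"
proof -
  \<comment> \<open>With \<open>x = 1/t\<close> this is the decay of \<open>x\<^sup>n / exp x\<close> at infinity.\<close>
  have "((\<lambda>t::real. (inverse t) ^ n / exp (inverse t)) \<longlongrightarrow> 0) (at_right 0)"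
    by (rule filterlim_compose[OF tendsto_power_div_exp_0 filterlim_inverse_at_top_right])
  then have "(flat_exp n \<longlongrightarrow> 0) (at_right 0)"
    by (rule Lim_transform_eventually)
      (auto simp: eventually_at_filter flat_exp_def exp_minus divide_inverse mult.commute)
  moreover have "(flat_exp n \<longlongrightarrow> 0) (at_left 0)"
    by (rule tendsto_eventually) (auto simp: eventually_at_filter flat_exp_def)
  ultimately show ?thesis by (simp add: filterlim_at_split)
qed

lemma flat_exp_deriv:
  "(flat_exp n has_real_derivative flat_exp (n + 2) t - n * flat_exp (n + 1) t) (at t)"
proof -
  consider "t > 0" | "t < 0" | "t = 0" by linarith
  then show ?thesis
  proof cases
    case 1
    define i where "i = inverse t"
    have i: "(inverse has_real_derivative (- (i ^ 2))) (at t)"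
      using DERIV_inverse[of t] 1 by (simp add: i_def numeral_2_eq_2)
    have e: "((\<lambda>t. exp (- inverse t)) has_real_derivative (exp (- i) * i ^ 2)) (at t)"
      using DERIV_fun_exp[OF DERIV_minus[OF i]] by (simp add: i_def)
    have "((\<lambda>t. exp (- inverse t) * inverse t ^ n) has_real_derivative
        flat_exp (n + 2) t - n * flat_exp (n + 1) t) (at t)"
    proof (cases n)
      case 0
      then show ?thesis using e 1 by (simp add: flat_exp_def i_def power2_eq_square)
    next
      case (Suc m)
      show ?thesis
        unfolding Suc
        by (rule DERIV_cong[OF DERIV_mult[OF e DERIV_power_Suc[OF i]]])
          (use 1 in \<open>simp add: flat_exp_def algebra_simps power2_eq_square flip: i_def\<close>)
    qed
    then show ?thesis
      using 1 has_field_derivative_transform_within_open[of _ _ t "{0<..}" "flat_exp n"]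
      by (auto simp: flat_exp_def)
  next
    case 2
    have "((\<lambda>t. 0) has_real_derivative flat_exp (n + 2) t - n * flat_exp (n + 1) t) (at t)"
      using 2 by (simp add: flat_exp_def)
    then show ?thesis
      using 2 has_field_derivative_transform_within_open[of "\<lambda>t. 0" _ t "{..<0}" "flat_exp n"]
      by (auto simp: flat_exp_def)
  next
    case 3
    have "(flat_exp n (0 + h) - flat_exp n 0) / h = flat_exp (n + 1) h" for h
      by (simp add: flat_exp_def divide_inverse)
    then have "(flat_exp n has_real_derivative 0) (at 0)"
      unfolding DERIV_def using flat_exp_tendsto_0[of "n + 1"] by simp
    then show ?thesis using 3 by (simp add: flat_exp_def)
  qed
qed

lemma Ck_on_flat_exp: "Ck_on k UNIV (flat_exp n)"
proof (induction k arbitrary: n)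
  case 0
  show ?case
    using DERIV_isCont[OF flat_exp_deriv] by (auto intro!: continuous_at_imp_continuous_on)
next
  case (Suc k)
  let ?D = "\<lambda>t h. h *\<^sub>R (flat_exp (n + 2) t + (- real n) *\<^sub>R flat_exp (n + 1) t)"
  have D: "(flat_exp n has_derivative ?D t) (at t)" for t
    using flat_exp_deriv[of n t] unfolding has_field_derivative_def
    by (rule has_derivative_eq_rhs) (simp add: fun_eq_iff)
  have "Ck_on k UNIV (\<lambda>t. ?D t h)" for h
    by (intro Ck_on_bounded_linear[OF _ _ bounded_linear_scaleR_right] Ck_on_add Suc open_UNIV)
  then show ?case
    by (rule Ck_on_SucI[OF open_UNIV D])
qed

lemma Ck_on_ident: "Ck_on k UNIV (\<lambda>x. x)"
proof (cases k)
  case (Suc k')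
  show ?thesis
    unfolding Suc by (rule Ck_on_SucI[where D = "\<lambda>x h. h"]) (auto intro: Ck_on_const)
qed simp

lemma smooth_bump_exists:
  fixes a :: "'k::euclidean_space"
  assumes "r > 0"
  obtains h :: "'k \<Rightarrow> real" where "smooth_on UNIV h" "h a = 1" "\<And>y. y \<notin> cball a r \<Longrightarrow> h y = 0"
proof
  \<comment> \<open>The quadratic polynomial \<open>q\<close> is positive exactly on the open ball.\<close>
  define q where "q y = r\<^sup>2 - (norm (y - a))\<^sup>2" for y :: 'k
  define c where "c = flat_exp 0 (r\<^sup>2)"
  have c: "c > 0" using assms by (simp add: c_def flat_exp_def)
  have "Ck_on k UNIV q" for k
  proof -
    have "Ck_on k UNIV (\<lambda>y::'k. (y - a) \<bullet> b)" for b
      using Ck_on_add[OF _ Ck_on_ident Ck_on_const, of k "- a"]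
      by (intro Ck_on_inner_left) auto
    then have "Ck_on k UNIV (\<lambda>y::'k. r\<^sup>2 + (-1) *\<^sub>R (\<Sum>b\<in>Basis. ((y - a) \<bullet> b) *\<^sub>R ((y - a) \<bullet> b)))"
      by (intro Ck_on_add Ck_on_sum Ck_on_scaleR[where g = "\<lambda>y. (y - a) \<bullet> b" for b]
          Ck_on_const Ck_on_bounded_linear[OF _ _ bounded_linear_scaleR_right[of "-1"]]) auto
    moreover have "q = (\<lambda>y. r\<^sup>2 + (-1) *\<^sub>R (\<Sum>b\<in>Basis. ((y - a) \<bullet> b) *\<^sub>R ((y - a) \<bullet> b)))"
    proof
      fix y :: 'k
      have "(norm (y - a))\<^sup>2 = (\<Sum>b\<in>Basis. ((y - a) \<bullet> b) * ((y - a) \<bullet> b))"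
        unfolding power2_norm_eq_inner by (rule euclidean_inner)
      then show "q y = r\<^sup>2 + (-1) *\<^sub>R (\<Sum>b\<in>Basis. ((y - a) \<bullet> b) *\<^sub>R ((y - a) \<bullet> b))"
        by (simp add: q_def)
    qed
    ultimately show ?thesis by simp
  qed
  then show "smooth_on UNIV (\<lambda>y. flat_exp 0 (q y) / c)"
    unfolding smooth_on_def
    by (intro allI Ck_on_bounded_linear[OF _ _ bounded_linear_divide]
        Ck_on_compose[OF _ _ Ck_on_flat_exp]) auto
  show "flat_exp 0 (q a) / c = 1" using c by (simp add: q_def c_def)
  show "flat_exp 0 (q y) / c = 0" if "y \<notin> cball a r" for y
  proof -
    have "r < norm (y - a)" using that by (simp add: dist_norm norm_minus_commute)
    then have "r\<^sup>2 < (norm (y - a))\<^sup>2" using assms by (simp add: power_strict_mono)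
    then show ?thesis by (simp add: q_def flat_exp_def)
  qed
qed

section \<open>Smooth functions, cutoffs and curves on manifolds\<close>

lemma smooth_map_on_iff:
  "smooth_map_on A W f \<longleftrightarrow>
    (\<forall>(U, \<phi>)\<in>A. \<forall>k. Ck_on k (\<phi> ` (U \<inter> W)) (\<lambda>y. f (inv_into U \<phi> y)))"
  by (simp add: smooth_map_on_def smooth_on_def comp_def)

lemma smooth_map_on_subset: "smooth_map_on A W f \<Longrightarrow> V \<subseteq> W \<Longrightarrow> smooth_map_on A V f"
  unfolding smooth_map_on_iff by (blast intro: Ck_on_subset)

context smooth_manifold
begin

lemma chart_props:
  assumes "(U, \<phi>) \<in> A"
  shows "open U" "inj_on \<phi> U" "continuous_on (\<phi> ` U) (inv_into U \<phi>)"
    and "open W \<Longrightarrow> open (\<phi> ` (U \<inter> W))"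
    and "y \<in> \<phi> ` (U \<inter> W) \<Longrightarrow> inv_into U \<phi> y \<in> U \<inter> W"
proof -
  from chart[OF assms] obtain \<psi> where o: "open U" "open (\<phi> ` U)"
    and h: "homeomorphism U (\<phi> ` U) \<phi> \<psi>" by blast
  show "open U" by fact
  show inj: "inj_on \<phi> U" using h unfolding homeomorphism_def by (metis inj_on_inverseI)
  have "\<psi> y = inv_into U \<phi> y" if "y \<in> \<phi> ` U" for y
    using that h inj by (force simp: homeomorphism_def)
  then show "continuous_on (\<phi> ` U) (inv_into U \<phi>)"
    using h continuous_on_cong unfolding homeomorphism_def by metis
  show "open (\<phi> ` (U \<inter> W))" if "open W"
    using homeomorphism_imp_open_map[OF h, of "U \<inter> W"] o that
    by (simp add: openin_open_eq open_Int)
  show "inv_into U \<phi> y \<in> U \<inter> W" if "y \<in> \<phi> ` (U \<inter> W)"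
    using that inj by auto
qed

lemma smooth_map_on_cong:
  assumes "open W" "\<And>y. y \<in> W \<Longrightarrow> f y = g y"
  shows "smooth_map_on A W f \<longleftrightarrow> smooth_map_on A W g"
proof -
  have "Ck_on k (\<phi> ` (U \<inter> W)) (\<lambda>y. f (inv_into U \<phi> y)) \<longleftrightarrow>
      Ck_on k (\<phi> ` (U \<inter> W)) (\<lambda>y. g (inv_into U \<phi> y))" if "(U, \<phi>) \<in> A" for k U \<phi>
    using assms chart_props(4,5)[OF that] by (intro Ck_on_cong) auto
  then show ?thesis unfolding smooth_map_on_iff by blast
qed

lemma smooth_map_on_Un:
  assumes "open V" "open W" "smooth_map_on A V f" "smooth_map_on A W f"
  shows "smooth_map_on A (V \<union> W) f"
  using assms chart_props(4) unfolding smooth_map_on_iff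
  by (auto simp: Int_Un_distrib image_Un intro!: Ck_on_Un)

lemma smooth_map_on_const: "open W \<Longrightarrow> smooth_map_on A W (\<lambda>y. c)"
  using chart_props(4) unfolding smooth_map_on_iff by (auto intro!: Ck_on_const)

lemma smooth_map_on_add:
  "open W \<Longrightarrow> smooth_map_on A W f \<Longrightarrow> smooth_map_on A W g \<Longrightarrow> smooth_map_on A W (\<lambda>y. f y + g y)"
  using chart_props(4) unfolding smooth_map_on_iff by (fast intro!: Ck_on_add)

lemma smooth_map_on_sum:
  assumes "open W" "finite B" "\<And>b. b \<in> B \<Longrightarrow> smooth_map_on A W (f b)"
  shows "smooth_map_on A W (\<lambda>y. \<Sum>b\<in>B. f b y)"
  using assms(2,3)
  by (induction B rule: finite_induct) (auto intro: smooth_map_on_const smooth_map_on_add assms(1))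

lemma smooth_map_on_scaleR:
  "open W \<Longrightarrow> smooth_map_on A W f \<Longrightarrow> smooth_map_on A W g \<Longrightarrow> smooth_map_on A W (\<lambda>y. f y *\<^sub>R g y)"
  using chart_props(4) unfolding smooth_map_on_iff by (fast intro!: Ck_on_scaleR)

lemma smooth_map_on_inner_left:
  fixes f :: "'m \<Rightarrow> 'b::euclidean_space"
  shows "open W \<Longrightarrow> smooth_map_on A W f \<Longrightarrow> smooth_map_on A W (\<lambda>y. f y \<bullet> b)"
  using chart_props(4) unfolding smooth_map_on_iff
  by (fast intro!: Ck_on_inner_left)

lemma smooth_functions_const: "(\<lambda>y. c) \<in> smooth_functions A"
  by (simp add: smooth_functions_def smooth_map_on_const)

lemma smooth_functions_add:
  "f \<in> smooth_functions A \<Longrightarrow> h \<in> smooth_functions A \<Longrightarrow> (\<lambda>y. f y + h y) \<in> smooth_functions A"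
  by (simp add: smooth_functions_def smooth_map_on_add)

lemma smooth_functions_mult:
  "f \<in> smooth_functions A \<Longrightarrow> h \<in> smooth_functions A \<Longrightarrow> (\<lambda>y. f y * h y) \<in> smooth_functions A"
  using smooth_map_on_scaleR[of UNIV f h] by (simp add: smooth_functions_def)

text \<open>A function that cuts off smoothly inside \<open>W\<close>: its support is closed in the whole manifold, not
  merely in \<open>W\<close>, so that its product with anything smooth on \<open>W\<close> extends smoothly by \<open>0\<close>.\<close>

definition cutoff :: "('m \<Rightarrow> real) \<Rightarrow> 'm set \<Rightarrow> bool" where
  "cutoff \<rho> W \<longleftrightarrow> \<rho> \<in> smooth_functions A \<and> (\<exists>C\<subseteq>W. closed C \<and> (\<forall>y. y \<notin> C \<longrightarrow> \<rho> y = 0))"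

text \<open>The Hausdorff property enters here: the support is compact in a chart, and compact sets
  are closed.\<close>

lemma cutoff_exists:
  assumes "open W" "x \<in> W"
  obtains \<rho> where "cutoff \<rho> W" "\<rho> x = 1"
proof -
  obtain U \<phi> where c: "(U, \<phi>) \<in> A" and x: "x \<in> U" using charts_cover by blast
  note cp = chart_props[OF c]
  have "open (\<phi> ` (U \<inter> W))" "\<phi> x \<in> \<phi> ` (U \<inter> W)" using cp assms x by auto
  then obtain r where r: "r > 0" "cball (\<phi> x) r \<subseteq> \<phi> ` (U \<inter> W)" by (meson open_contains_cball)
  obtain h :: "'k \<Rightarrow> real" where h: "smooth_on UNIV h" "h (\<phi> x) = 1"
    and h0: "\<And>y. y \<notin> cball (\<phi> x) r \<Longrightarrow> h y = 0"
    using smooth_bump_exists[OF r(1)] by metis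
  define C where "C = inv_into U \<phi> ` cball (\<phi> x) r"
  define \<rho> where "\<rho> y = (if y \<in> U then h (\<phi> y) else 0)" for y
  have "continuous_on (cball (\<phi> x) r) (inv_into U \<phi>)"
    using cp(3) r(2) by (blast intro: continuous_on_subset)
  then have "compact C" unfolding C_def by (intro compact_continuous_image compact_cball)
  then have C: "closed C" by (rule compact_imp_closed)
  have CW: "C \<subseteq> U \<inter> W" using r(2) cp(5) unfolding C_def by blast
  have \<rho>0: "\<rho> y = 0" if "y \<notin> C" for y
  proof (cases "y \<in> U")
    case True
    then have "\<phi> y \<notin> cball (\<phi> x) r"
      using that inv_into_f_f[OF cp(2) True] unfolding C_def by (metis image_eqI)
    then show ?thesis using h0 by (simp add: \<rho>_def)
  qed (simp add: \<rho>_def)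
  have "smooth_map_on A U (\<lambda>y. h (\<phi> y))"
    unfolding smooth_map_on_iff
  proof (clarify)
    fix V \<sigma> k assume v: "(V, \<sigma>) \<in> A"
    have "Ck_on k (\<sigma> ` (V \<inter> U)) (\<lambda>y. \<phi> (inv_into V \<sigma> y))"
      using charts_compatible[OF v c] by (simp add: smooth_on_def comp_def)
    then show "Ck_on k (\<sigma> ` (V \<inter> U)) (\<lambda>y. h (\<phi> (inv_into V \<sigma> y)))"
      using h(1) by (intro Ck_on_compose[OF chart_props(4)[OF v cp(1)], where g = h and T = UNIV])
        (auto simp: smooth_on_def)
  qed
  then have "smooth_map_on A U \<rho>"
    using smooth_map_on_cong[OF cp(1), of \<rho> "\<lambda>y. h (\<phi> y)"] by (simp add: \<rho>_def)
  moreover have "smooth_map_on A (- C) \<rho>"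
    using smooth_map_on_cong[of "- C" \<rho> "\<lambda>y. 0"] C \<rho>0 by (simp add: smooth_map_on_const open_Compl)
  ultimately have "smooth_map_on A (U \<union> - C) \<rho>"
    using C cp(1) by (intro smooth_map_on_Un) auto
  moreover have "U \<union> - C = UNIV" using CW by auto
  ultimately have "cutoff \<rho> W"
    using C CW \<rho>0 unfolding cutoff_def smooth_functions_def by auto
  moreover have "\<rho> x = 1" using x h by (simp add: \<rho>_def)
  ultimately show ?thesis by (rule that)
qed

lemma cutoff_zero: "cutoff \<rho> W \<Longrightarrow> y \<notin> W \<Longrightarrow> \<rho> y = 0"
  unfolding cutoff_def by blast

lemma cutoff_scaleR_smooth:
  assumes "cutoff \<rho> W" "open W" "open V" "smooth_map_on A (V \<inter> W) f"
  shows "smooth_map_on A V (\<lambda>y. \<rho> y *\<^sub>R f y)"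
proof -
  from assms(1) obtain C where C: "C \<subseteq> W" "closed C" "\<And>y. y \<notin> C \<Longrightarrow> \<rho> y = 0"
    and \<rho>: "smooth_map_on A UNIV \<rho>" unfolding cutoff_def smooth_functions_def by blast
  have "smooth_map_on A (V \<inter> W) (\<lambda>y. \<rho> y *\<^sub>R f y)"
    using assms \<rho> by (intro smooth_map_on_scaleR smooth_map_on_subset[OF \<rho>]) auto
  moreover have "smooth_map_on A (V \<inter> - C) (\<lambda>y. \<rho> y *\<^sub>R f y)"
    using smooth_map_on_cong[of "V \<inter> - C" "\<lambda>y. \<rho> y *\<^sub>R f y" "\<lambda>y. 0"] C assms(3)
    by (simp add: smooth_map_on_const open_Int open_Compl)
  ultimately have "smooth_map_on A ((V \<inter> W) \<union> (V \<inter> - C)) (\<lambda>y. \<rho> y *\<^sub>R f y)"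
    using C assms by (intro smooth_map_on_Un) auto
  moreover have "(V \<inter> W) \<union> (V \<inter> - C) = V" using C by auto
  ultimately show ?thesis by simp
qed

text \<open>Near \<open>t\<close> the map \<open>f \<circ> \<gamma>\<close> factors through a chart as a composition of two maps between
  Euclidean spaces.\<close>

lemma smooth_along_curve_differentiable:
  fixes f :: "'m \<Rightarrow> 'b::real_normed_vector"
  assumes "open I" "t \<in> I" "smooth_curve_on A I \<gamma>" "open W" "\<gamma> t \<in> W" "smooth_map_on A W f"
  shows "(f \<circ> \<gamma>) differentiable (at t)"
proof -
  obtain U \<phi> where c: "(U, \<phi>) \<in> A" and x: "\<gamma> t \<in> U" using charts_cover by blast
  note cp = chart_props[OF c]
  have \<gamma>: "continuous_on I \<gamma>" and s: "smooth_on {t\<in>I. \<gamma> t \<in> U} (\<phi> \<circ> \<gamma>)"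
    using assms(3) c unfolding smooth_curve_on_def by auto
  let ?F = "\<lambda>y. f (inv_into U \<phi> y)"
  have "Ck_on 1 (\<phi> ` (U \<inter> W)) ?F" using assms(6) c unfolding smooth_map_on_iff by blast
  then have F: "?F differentiable (at (\<phi> (\<gamma> t)))" using x assms(5) by auto
  have "Ck_on 1 {t\<in>I. \<gamma> t \<in> U} (\<phi> \<circ> \<gamma>)" using s unfolding smooth_on_def by blast
  then have G: "(\<phi> \<circ> \<gamma>) differentiable (at t)" using x assms(2) by auto
  have "(?F \<circ> (\<phi> \<circ> \<gamma>)) differentiable (at t)"
    by (rule differentiable_chain_at[OF G]) (use F in simp)
  moreover have "open (I \<inter> \<gamma> -` U)" using \<gamma> assms(1) cp(1) by (simp add: continuous_on_open_vimage Int_commute)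
  moreover have "(?F \<circ> (\<phi> \<circ> \<gamma>)) u = (f \<circ> \<gamma>) u" if "u \<in> I \<inter> \<gamma> -` U" for u
    using that inv_into_f_f[OF cp(2)] by simp
  ultimately show ?thesis
    using x assms(2) has_derivative_transform_within_open[of "?F \<circ> (\<phi> \<circ> \<gamma>)" _ t UNIV "I \<inter> \<gamma> -` U" "f \<circ> \<gamma>"]
    unfolding differentiable_def by blast
qed

lemma curve_eventually_in:
  assumes "open I" "t \<in> I" "smooth_curve_on A I \<gamma>" "open W" "\<gamma> t \<in> W"
  shows "\<forall>\<^sub>F u in nhds t. \<gamma> u \<in> W"
proof -
  have "isCont \<gamma> t" using assms unfolding smooth_curve_on_def
    by (auto simp: continuous_on_eq_continuous_at)
  then have "(\<gamma> \<longlongrightarrow> \<gamma> t) (nhds t)" by (simp add: continuous_at tendsto_at_iff_tendsto_nhds)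
  then show ?thesis using assms by (simp add: topological_tendstoD)
qed

lemma velocity_in_tangent_space:
  assumes "open I" "t \<in> I" "smooth_curve_on A I \<gamma>"
  shows "velocity A \<gamma> t \<in> tangent_space A (\<gamma> t)"
proof -
  have D: "(f \<circ> \<gamma>) field_differentiable (at t)" if "f \<in> smooth_functions A" for f
    using smooth_along_curve_differentiable[OF assms, of UNIV f] that
    by (auto simp: smooth_functions_def real_differentiable_def field_differentiable_def)
  show ?thesis
    unfolding tangent_space_def velocity_def
    using D D[unfolded comp_def]
    by (auto simp: smooth_functions_add smooth_functions_mult smooth_functions_const comp_def)
qed

text \<open>The Leibniz rule for \<open>1 = 1 * 1\<close> kills the value at \<open>1\<close>.\<close>

lemma tangent_const:
  assumes v: "v \<in> tangent_space A x"
  shows "v (\<lambda>y. c) = 0"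
proof -
  note sc = smooth_functions_const
  have prod: "v (\<lambda>y. f y * h y) = v f * h x + f x * v h" and scale: "v (\<lambda>y. a * f y) = a * v f"
    if "f \<in> smooth_functions A" "h \<in> smooth_functions A" for f h a
    using v that unfolding tangent_space_def by auto
  have "v (\<lambda>y. 1) = 0" using prod[OF sc sc, of 1 1] by simp
  then show ?thesis using scale[OF sc sc, of c 1] by simp
qed

end

section \<open>Linear maps of constant rank\<close>

text \<open>Pointwise convergence of linear maps in finite dimension is convergence in operator norm, and a
  map at distance less than \<open>1\<close> from
  the identity on \<open>S\<close> is injective on \<open>S\<close>.\<close>

lemma eventually_inj_on_near_identity:
  fixes G :: "'t \<Rightarrow> 'a::euclidean_space \<Rightarrow> 'a"
  assumes lin: "\<forall>\<^sub>F u in F. linear (G u)" and G0: "linear G0"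
    and lim: "\<And>w. ((\<lambda>u. G u w) \<longlongrightarrow> G0 w) F"
    and S: "subspace S" "\<And>y. y \<in> S \<Longrightarrow> G0 y = y"
  shows "\<forall>\<^sub>F u in F. inj_on (G u) S"
proof -
  have "((\<lambda>u. \<Sum>b\<in>Basis. norm (G u b - G0 b)) \<longlongrightarrow> (\<Sum>b\<in>(Basis::'a set). norm (G0 b - G0 b))) F"
    by (intro tendsto_intros lim)
  then have "((\<lambda>u. \<Sum>b\<in>Basis. norm (G u b - G0 b)) \<longlongrightarrow> 0) F" by simp
  then have "\<forall>\<^sub>F u in F. (\<Sum>b\<in>Basis. norm (G u b - G0 b)) < 1"
    by (rule order_tendstoD) simp
  with lin show ?thesis
  proof eventually_elim
    fix u assume u: "linear (G u)" "(\<Sum>b\<in>Basis. norm (G u b - G0 b)) < 1"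
    have "y = 0" if y: "y \<in> S" "G u y = 0" for y
    proof (rule ccontr)
      assume "y \<noteq> 0"
      have l: "linear (\<lambda>w. G u w - G0 w)" using u(1) G0 by (rule linear_compose_sub)
      have "norm y = norm (G u y - G0 y)" using y S by simp
      also have "G u y - G0 y = (\<Sum>b\<in>Basis. (y \<bullet> b) *\<^sub>R (G u b - G0 b))"
        using arg_cong[OF euclidean_representation[of y], of "\<lambda>w. G u w - G0 w"]
        by (simp only: linear_sum[OF l] linear_cmul[OF l])
      also have "norm \<dots> \<le> (\<Sum>b\<in>Basis. norm y * norm (G u b - G0 b))"
        by (intro sum_norm_le) (auto intro!: mult_right_mono Basis_le_norm)
      also have "\<dots> = norm y * (\<Sum>b\<in>Basis. norm (G u b - G0 b))" by (simp add: sum_distrib_left)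
      also have "\<dots> < norm y * 1" using u(2) \<open>y \<noteq> 0\<close> by (intro mult_strict_left_mono) auto
      finally show False by simp
    qed
    then show "inj_on (G u) S" using linear_inj_on_iff_eq_0[OF u(1) S(1)] by blast
  qed
qed

text \<open>If \<open>z'\<close> were outside the range \<open>R\<close> of \<open>F 0\<close>, the span \<open>S\<close> of \<open>z'\<close> and \<open>R\<close> would have dimension one
  more than \<open>R\<close>. For small \<open>u \<noteq> 0\<close> the space \<open>S\<close> embeds into the range of \<open>F u\<close>: send \<open>F 0 p\<close> to \<open>F u p\<close>
  and \<open>z'\<close> to \<open>z u / u\<close>, a map close to the identity. This contradicts the bound on the rank. No
  smooth choice of kernel vectors is involved.\<close>

lemma derivative_in_range_of_constant_rank:
  fixes F :: "real \<Rightarrow> 'a::euclidean_space \<Rightarrow> 'b::euclidean_space"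
  assumes lin: "\<forall>\<^sub>F u in nhds 0. linear (F u)"
    and lim: "\<And>w. ((\<lambda>u. F u w) \<longlongrightarrow> F 0 w) (at 0)"
    and rank: "\<forall>\<^sub>F u in nhds 0. dim (range (F u)) \<le> dim (range (F 0))"
    and z: "(z has_vector_derivative z') (at 0)" "z 0 = 0" "\<forall>\<^sub>F u in nhds 0. z u \<in> range (F u)"
  shows "z' \<in> range (F 0)"
proof (rule ccontr)
  assume notin: "z' \<notin> range (F 0)"
  have F0: "linear (F 0)" using lin by (rule eventually_nhds_x_imp_x)
  then have R: "subspace (range (F 0))" by (simp add: linear_subspace_image)
  then have sp: "span (range (F 0)) = range (F 0)" by simp
  obtain P where P: "linear P" "\<And>y. y \<in> range (F 0) \<Longrightarrow> F 0 (P y) = y"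
    using linear_exists_right_inverse_on[OF F0 subspace_UNIV] by auto
  obtain y0 \<xi> where y0: "y0 \<in> range (F 0)" and \<xi>: "\<And>w. w \<in> range (F 0) \<Longrightarrow> orthogonal \<xi> w"
    and z': "z' = y0 + \<xi>"
    using orthogonal_subspace_decomp_exists[of "range (F 0)" z'] unfolding sp by metis
  \<comment> \<open>The functional \<open>l\<close> vanishes on the range of \<open>F 0\<close> and takes the value \<open>1\<close> at \<open>z'\<close>.\<close>
  define l where "l y = (y \<bullet> \<xi>) / (\<xi> \<bullet> \<xi>)" for y
  have "\<xi> \<noteq> 0" using notin y0 z' by auto
  then have l1: "l z' = 1"
    using \<xi>[OF y0] by (simp add: l_def z' orthogonal_def inner_commute[of y0] inner_add_left)
  have l0: "l y = 0" if "y \<in> range (F 0)" for y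
    using \<xi>[OF that] by (simp add: l_def orthogonal_def inner_commute)
  have ll: "linear l" unfolding l_def
    by (intro linearI) (simp_all add: inner_add_left add_divide_distrib)
  \<comment> \<open>\<open>P\<close> picks preimages under \<open>F 0\<close>, so \<open>G u\<close> moves \<open>S\<close> into the range of \<open>F u\<close> and \<open>G0\<close> fixes \<open>S\<close>.\<close>
  define G where "G u y = F u (P (y - l y *\<^sub>R z')) + l y *\<^sub>R (z u /\<^sub>R u)" for u y
  define G0 where "G0 y = F 0 (P (y - l y *\<^sub>R z')) + l y *\<^sub>R z'" for y
  define S where "S = span (insert z' (range (F 0)))"
  have lin_sum: "linear (\<lambda>y. f (P (y - l y *\<^sub>R z')) + l y *\<^sub>R w)" if "linear f"
    for f :: "'a \<Rightarrow> 'b" and w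
    by (rule linearI) (simp_all add: linear_add[OF ll] linear_cmul[OF ll] linear_add[OF P(1)]
        linear_diff[OF P(1)] linear_cmul[OF P(1)] linear_add[OF that] linear_diff[OF that]
        linear_cmul[OF that] algebra_simps)
  have linG: "\<forall>\<^sub>F u in at 0. linear (G u)"
    using eventually_nhds_conv_at[THEN iffD1, OF lin, THEN conjunct1] unfolding G_def
    by (rule eventually_mono) (rule lin_sum)
  have "linear G0" unfolding G0_def by (intro lin_sum F0)
  moreover have "((\<lambda>u. G u w) \<longlongrightarrow> G0 w) (at 0)" for w
  proof -
    have "((\<lambda>u. norm (z u - u *\<^sub>R z') / norm u) \<longlongrightarrow> 0) (at 0)"
      using z(1,2) by (simp add: has_vector_derivative_def has_derivative_at)
    moreover have "norm (z u - u *\<^sub>R z') / norm u = norm (z u /\<^sub>R u - z')" if "u \<noteq> 0" for u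
    proof -
      have "z u /\<^sub>R u - z' = (z u - u *\<^sub>R z') /\<^sub>R u" using that by (simp add: scaleR_diff_right)
      then show ?thesis by (simp add: divide_inverse)
    qed
    ultimately have "((\<lambda>u. norm (z u /\<^sub>R u - z')) \<longlongrightarrow> 0) (at 0)"
      by (elim Lim_transform_eventually) (simp add: eventually_at_filter)
    then have "((\<lambda>u. z u /\<^sub>R u) \<longlongrightarrow> z') (at 0)"
      by (rule LIM_zero_cancel[OF tendsto_norm_zero_cancel])
    then show ?thesis unfolding G_def G0_def by (intro tendsto_intros lim)
  qed
  moreover have "G0 y = y" if y: "y \<in> S" for y
  proof -
    obtain k where k: "y - k *\<^sub>R z' \<in> range (F 0)"
      using y span_breakdown_eq[of y z' "range (F 0)"] unfolding S_def sp by auto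
    then have "l y = k" using l0[OF k] l1 linear_diff[OF ll] linear_cmul[OF ll] by simp
    then show ?thesis using P(2)[OF k] by (simp add: G0_def)
  qed
  ultimately have inj: "\<forall>\<^sub>F u in at 0. inj_on (G u) S"
    using linG by (intro eventually_inj_on_near_identity[where ?G0.0 = G0]) (auto simp: S_def)
  have "\<forall>\<^sub>F u in at 0. linear (G u) \<and> inj_on (G u) S \<and> linear (F u) \<and> z u \<in> range (F u) \<and>
      dim (range (F u)) \<le> dim (range (F 0))"
    using inj lin rank z(3) linG
    unfolding eventually_nhds_conv_at eventually_conj_iff by blast
  then obtain u where u: "linear (G u)" "inj_on (G u) S" "linear (F u)" "z u \<in> range (F u)"
      "dim (range (F u)) \<le> dim (range (F 0))"
    using eventually_happens[of _ "at (0::real)"] by (metis (no_types, lifting) trivial_limit_at)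
  have "subspace (range (F u))" using u(3) by (simp add: linear_subspace_image)
  then have "G u ` S \<subseteq> range (F u)"
    using u(4) unfolding G_def by (auto intro!: subspace_add subspace_scale)
  then have "dim (G u ` S) \<le> dim (range (F 0))" using u(5) dim_subset by (meson order_trans)
  moreover have "dim (G u ` S) = dim S"
    using u(1,2) by (intro dim_image_eq) (auto simp: S_def span_span)
  moreover have "dim S = dim (range (F 0)) + 1"
    using notin by (simp add: S_def dim_insert sp)
  ultimately show False by simp
qed

text \<open>The map restricts to a bijection from the orthogonal complement of its kernel onto its range.\<close>

lemma dim_range_eq_codim_kernel:
  fixes f :: "'a::euclidean_space \<Rightarrow> 'b::euclidean_space"
  assumes "linear f"
  shows "dim (range f) + dim {w. f w = 0} = DIM('a)"
proof -
  let ?K = "{w. f w = 0}"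
  define T where "T = {y. \<forall>x\<in>?K. orthogonal x y}"
  have K: "subspace ?K" using assms by (rule linear_subspace_kernel)
  have T: "subspace T" unfolding T_def by (rule subspace_orthogonal_to_vectors)
  have d: "dim T + dim ?K = DIM('a)"
    using dim_subspace_orthogonal_to_vectors[OF K subspace_UNIV] by (simp add: T_def)
  have inj: "inj_on f T"
    unfolding linear_inj_on_iff_eq_0[OF assms T] by (auto simp: T_def orthogonal_self)
  have "range f \<subseteq> f ` T"
  proof clarify
    fix w
    obtain y y' where y: "y \<in> span ?K" "\<And>x. x \<in> span ?K \<Longrightarrow> orthogonal y' x" "w = y + y'"
      by (rule orthogonal_subspace_decomp_exists[of ?K w]) blast
    then have "f y = 0" using K by (simp add: span_eq_iff[THEN iffD2])
    then have "f w = f y'" using y(3) linear_add[OF assms] by simp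
    moreover have "y' \<in> T" unfolding T_def using y(2) by (auto simp: orthogonal_commute span_base)
    ultimately show "f w \<in> f ` T" by blast
  qed
  then have "range f = f ` T" by auto
  moreover have "dim (f ` T) = dim T"
    using assms inj T by (intro dim_image_eq) (auto simp: span_eq_iff[THEN iffD2])
  ultimately show ?thesis using d by simp
qed

text \<open>By hypothesis \<open>C\<close> is injective on its range; by dimension it then maps its range onto itself.\<close>

lemma index_le_one_imp_image_eq:
  fixes C :: "'a::euclidean_space \<Rightarrow> 'a"
  assumes C: "linear C" and idx: "\<And>a. C (C a) = 0 \<Longrightarrow> C a = 0"
  obtains a where "C w = C (C a)"
proof -
  have T: "subspace (range C)" using C by (simp add: linear_subspace_image)
  have "inj_on C (range C)" using linear_inj_on_iff_eq_0[OF C T] idx by auto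
  then have "dim (C ` range C) = dim (range C)"
    using C T by (intro dim_image_eq) (auto simp: span_eq_iff[THEN iffD2])
  then have "C ` range C = range C"
    using C T by (intro subspace_dim_equal) (auto simp: linear_subspace_image)
  then show ?thesis using that by blast
qed

section \<open>The splitting defined by two orthogonal complex structures\<close>

lemma linear_map_onD:
  assumes "linear_map_on V W f" "subspace V"
  shows "a \<in> V \<Longrightarrow> f a \<in> W" "a \<in> V \<Longrightarrow> b \<in> V \<Longrightarrow> f (a + b) = f a + f b"
    "a \<in> V \<Longrightarrow> f (c *\<^sub>R a) = c *\<^sub>R f a" "f 0 = 0"
    "a \<in> V \<Longrightarrow> f (- a) = - f a" "a \<in> V \<Longrightarrow> b \<in> V \<Longrightarrow> f (a - b) = f a - f b"
proof -
  have add: "f (a + b) = f a + f b" if "a \<in> V" "b \<in> V" for a b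
    using assms that unfolding linear_map_on_def by auto
  have scale: "f (c *\<^sub>R a) = c *\<^sub>R f a" if "a \<in> V" for a c
    using assms that unfolding linear_map_on_def by auto
  have minus: "f (- a) = - f a" if "a \<in> V" for a using scale[of a "-1"] that by simp
  show "a \<in> V \<Longrightarrow> b \<in> V \<Longrightarrow> f (a + b) = f a + f b" "a \<in> V \<Longrightarrow> f (c *\<^sub>R a) = c *\<^sub>R f a"
    "a \<in> V \<Longrightarrow> f (- a) = - f a"
    using add scale minus by auto
  show "a \<in> V \<Longrightarrow> f a \<in> W" using assms unfolding linear_map_on_def by auto
  show "f 0 = 0" using scale[of 0 0] assms(2) by (simp add: subspace_0)
  show "a \<in> V \<Longrightarrow> b \<in> V \<Longrightarrow> f (a - b) = f a - f b"
    using add[of a "- b"] minus[of b] assms(2) by (simp add: subspace_neg)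
qed

lemma linear_map_on_sum:
  assumes f: "linear_map_on V W f" "subspace V" and e: "finite B" "\<And>b. b \<in> B \<Longrightarrow> e b \<in> V"
  shows "f (\<Sum>b\<in>B. c b *\<^sub>R e b) = (\<Sum>b\<in>B. c b *\<^sub>R f (e b))"
  using e
proof (induction B rule: finite_induct)
  case (insert b B)
  have "(\<Sum>b\<in>B. c b *\<^sub>R e b) \<in> V" using insert f(2) by (auto intro: subspace_sum subspace_scale)
  then show ?case using insert linear_map_onD[OF f] f(2) by (simp add: subspace_scale)
qed (simp add: linear_map_onD[OF f])

locale orthogonal_pair =
  fixes V :: "'f::real_vector set" and h :: "'f \<Rightarrow> 'f \<Rightarrow> real" and j k :: "'f \<Rightarrow> 'f"
  assumes sub: "subspace V"
    and h_lin: "a \<in> V \<Longrightarrow> linear_map_on V UNIV (h a)"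
    and h_sym: "a \<in> V \<Longrightarrow> b \<in> V \<Longrightarrow> h a b = h b a"
    and h_pos: "a \<in> V \<Longrightarrow> a \<noteq> 0 \<Longrightarrow> h a a > 0"
    and j: "j \<in> orth_complex_structures V h" and k: "k \<in> orth_complex_structures V h"
begin

lemma j_lin: "linear_map_on V V j" and k_lin: "linear_map_on V V k"
  and jj: "a \<in> V \<Longrightarrow> j (j a) = - a" and kk: "a \<in> V \<Longrightarrow> k (k a) = - a"
  using j k unfolding orth_complex_structures_def by auto

lemmas closed = subspace_add[OF sub] subspace_diff[OF sub] subspace_neg[OF sub]
  subspace_scale[OF sub] subspace_0[OF sub] linear_map_onD(1)[OF j_lin sub]
  linear_map_onD(1)[OF k_lin sub]

lemmas lin = linear_map_onD(2-)[OF j_lin sub] linear_map_onD(2-)[OF k_lin sub]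

abbreviation comm :: "'f \<Rightarrow> 'f" where "comm e \<equiv> j (k e) - k (j e)"

lemma comm_lin: "linear_map_on V V comm"
  unfolding linear_map_on_def by (auto simp: closed lin algebra_simps)

text \<open>An isometry with square \<open>-1\<close> is skew.\<close>

lemma skew:
  assumes "a \<in> V" "b \<in> V"
  shows "h (j a) b = - h a (j b)" "h (k a) b = - h a (k b)"
proof -
  have *: "h (i a) b = - h a (i b)" if i: "i \<in> orth_complex_structures V h" for i
  proof -
    have l: "linear_map_on V V i" and ii: "i (i b) = - b"
      and iso: "\<And>c d. c \<in> V \<Longrightarrow> d \<in> V \<Longrightarrow> h (i c) (i d) = h c d"
      using i assms unfolding orth_complex_structures_def by auto
    note iV = linear_map_onD(1)[OF l sub]
    show ?thesis
      using iso[OF assms(1) iV[OF assms(2)]] linear_map_onD(5)[OF h_lin[OF iV[OF assms(1)]] sub assms(2)]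
      unfolding ii by simp
  qed
  show "h (j a) b = - h a (j b)" "h (k a) b = - h a (k b)" using *[OF j] *[OF k] by auto
qed

text \<open>The commutator \<open>C\<close> of two skew maps is skew, hence \<open>h (C a) (C a) = - h a (C (C a))\<close>.\<close>

lemma comm_inj_on_image:
  assumes a: "a \<in> V" and 0: "comm (comm a) = 0"
  shows "comm a = 0"
proof -
  let ?b = "comm a"
  have b: "?b \<in> V" using a closed by auto
  have h2: "h (a1 - a2) a3 = h a1 a3 - h a2 a3" if "a1 \<in> V" "a2 \<in> V" "a3 \<in> V" for a1 a2 a3
    using that linear_map_onD(6)[OF h_lin[of a3] sub, of a1 a2]
    by (simp add: h_sym[of _ a3] closed)
  have "h ?b ?b = h (j (k a)) ?b - h (k (j a)) ?b" by (intro h2) (use a b closed in auto)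
  also have "\<dots> = h a (k (j ?b)) - h a (j (k ?b))"
    using a b by (simp only: skew closed minus_minus)
  also have "\<dots> = - h a (comm ?b)"
    using linear_map_onD(6)[OF h_lin[OF a] sub, of "j (k ?b)" "k (j ?b)"] b closed by simp
  also have "\<dots> = 0" unfolding 0 using linear_map_onD(4)[OF h_lin[OF a] sub] by simp
  finally show ?thesis using h_pos[OF b] by force
qed

lemma ker_sum_ker_diff_comm:
  assumes "e \<in> ker_sum V j k \<or> e \<in> ker_diff V j k"
  shows "e \<in> V" "comm e = 0"
proof -
  show e: "e \<in> V" using assms unfolding ker_sum_def ker_diff_def by auto
  have "k e = - j e \<or> k e = j e"
    using assms unfolding ker_sum_def ker_diff_def by (auto simp: add_eq_0_iff)
  then show "comm e = 0"
  proof
    assume *: "k e = - j e"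
    have "j (k e) = e" unfolding * using e by (simp add: lin closed jj)
    moreover have "k (j e) = - k (k e)" unfolding * using e by (simp add: lin closed)
    ultimately show ?thesis using kk[OF e] by simp
  next
    assume *: "k e = j e"
    have "k (j e) = - e" unfolding *[symmetric] by (rule kk[OF e])
    then show ?thesis unfolding * using jj[OF e] by simp
  qed
qed

text \<open>The sum \<open>b + c\<close> is killed by the commutator, and the commutator is injective on its image, so
  \<open>a = 0\<close>. A vector in both kernels satisfies \<open>2 j b = 0\<close>.\<close>

lemma splitting_independent:
  assumes "a \<in> im_commutator V j k" "b \<in> ker_sum V j k" "c \<in> ker_diff V j k" "a + b + c = 0"
  shows "a = 0" "b = 0" "c = 0"
proof -
  note b = ker_sum_ker_diff_comm[OF disjI1[OF assms(2)]]
    and c = ker_sum_ker_diff_comm[OF disjI2[OF assms(3)]]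
  note C = linear_map_onD[OF comm_lin sub]
  obtain a' where a': "a' \<in> V" "a = comm a'" using assms(1) unfolding im_commutator_def by auto
  have "a = - (b + c)" using assms(4) by (metis add.assoc eq_neg_iff_add_eq_0)
  moreover have "comm (- (b + c)) = 0" using b c C(5)[of "b + c"] C(2)[of b c] closed by simp
  ultimately have "comm (comm a') = 0" using a' by metis
  then show "a = 0" using comm_inj_on_image a' by simp
  then have c': "c = - b" using assms(4) by (simp add: eq_neg_iff_add_eq_0 add.commute)
  have 1: "j b + k b = 0" using assms(2) unfolding ker_sum_def by auto
  have 2: "j b = k b" using assms(3) b unfolding ker_diff_def c' by (simp add: lin)
  have "2 *\<^sub>R j b = 0" using 1 unfolding 2[symmetric] by (simp add: scaleR_2)
  then have "j b = 0" by simp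
  then show "b = 0" using jj[OF b(1)] lin(3) by simp
  then show "c = 0" using c' by simp
qed

lemma splitting_components_eq:
  assumes "a \<in> im_commutator V j k" "b \<in> ker_sum V j k" "c \<in> ker_diff V j k" "e = a + b + c"
  shows "splitting_components (im_commutator V j k) (ker_sum V j k) (ker_diff V j k) e = (a, b, c)"
proof -
  have d: "x - y \<in> im_commutator V j k"
    if xy: "x \<in> im_commutator V j k" "y \<in> im_commutator V j k" for x y
  proof -
    obtain x' y' where *: "x' \<in> V" "x = comm x'" "y' \<in> V" "y = comm y'"
      using xy unfolding im_commutator_def by auto
    then have "x - y = comm (x' - y')" using linear_map_onD(6)[OF comm_lin sub, of x' y'] by simp
    then show ?thesis using * closed unfolding im_commutator_def by blast
  qed
  have uniq: "a' = a \<and> b' = b \<and> c' = c"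
    if *: "a' \<in> im_commutator V j k" "b' \<in> ker_sum V j k" "c' \<in> ker_diff V j k" "e = a' + b' + c'"
    for a' b' c'
  proof -
    have "b' - b \<in> ker_sum V j k"
      using *(2) assms(2) closed unfolding ker_sum_def by (auto simp: lin algebra_simps add_eq_0_iff)
    moreover have "c' - c \<in> ker_diff V j k"
      using *(3) assms(3) closed unfolding ker_diff_def by (auto simp: lin algebra_simps)
    moreover have "a' - a \<in> im_commutator V j k" using d * assms by auto
    moreover have "(a' - a) + (b' - b) + (c' - c) = 0" using * assms by (simp add: algebra_simps)
    ultimately show ?thesis using splitting_independent[of "a' - a" "b' - b" "c' - c"] by auto
  qed
  show ?thesis unfolding splitting_components_def
  proof (rule the_equality)
    fix p
    assume p: "case p of (a, b, c) \<Rightarrow>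
      a \<in> im_commutator V j k \<and> b \<in> ker_sum V j k \<and> c \<in> ker_diff V j k \<and> e = a + b + c"
    obtain a' b' c' where "p = (a', b', c')" by (cases p)
    then show "p = (a, b, c)" using p uniq[of a' b' c'] by simp
  qed (use assms in simp)
qed

text \<open>The premise on \<open>a\<close>, which finite dimension provides, says that \<open>d = e - [j, k] a\<close> is killed by
  the commutator. On the kernel of the commutator \<open>j k\<close> squares to the identity, and its two
  eigenspaces are the kernels of \<open>j + k\<close> and \<open>j - k\<close>.\<close>

lemma splitting_exists:
  assumes e: "e \<in> V" and a: "a \<in> V" "comm e = comm (comm a)"
  obtains b c where "b \<in> ker_sum V j k" "c \<in> ker_diff V j k" "e = comm a + b + c"
proof -
  define d where "d = e - comm a"
  have d: "d \<in> V" using e a closed unfolding d_def by auto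
  have "comm d = 0"
    using linear_map_onD(6)[OF comm_lin sub, of e "comm a"] e a closed unfolding d_def by simp
  then have jk: "k (j d) = j (k d)" by simp
  have kjk: "k (j (k d)) = - j d"
    using jk[symmetric] kk[of "j d"] d closed by simp
  have jjk: "j (j (k d)) = - k d" using jj d closed by simp
  have "(1/2) *\<^sub>R (d + j (k d)) \<in> ker_sum V j k"
    using d by (simp add: ker_sum_def lin closed kjk jjk flip: scaleR_add_right)
  moreover have "(1/2) *\<^sub>R (d - j (k d)) \<in> ker_diff V j k"
    using d by (simp add: ker_diff_def lin closed kjk jjk flip: scaleR_diff_right)
  moreover have "e = comm a + (1/2) *\<^sub>R (d + j (k d)) + (1/2) *\<^sub>R (d - j (k d))"
  proof -
    have "(1/2) *\<^sub>R (d + j (k d)) + (1/2) *\<^sub>R (d - j (k d)) = (1/2) *\<^sub>R (2 *\<^sub>R d)"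
      by (simp only: scaleR_add_right[symmetric] scaleR_2) simp
    then show ?thesis by (simp only: add.assoc) (simp add: d_def)
  qed
  ultimately show ?thesis using that by blast
qed

text \<open>Both \<open>j + k\<close> and \<open>j - k\<close> anticommute with \<open>[j, k]\<close> and hence preserve its image. Moreover
  \<open>j + k = 2 j\<close> on the kernel of \<open>j - k\<close>, and \<open>j - k = 2 j\<close> on the kernel of \<open>j + k\<close>.\<close>

lemma image_components:
  assumes a: "a \<in> V" and b: "b \<in> ker_sum V j k" and c: "c \<in> ker_diff V j k"
    and e: "e = comm a + b + c"
  shows "\<exists>p q. splitting_components (im_commutator V j k) (ker_sum V j k) (ker_diff V j k)
      (j e + k e) = (p, 0, q)"
    and "\<exists>p q. splitting_components (im_commutator V j k) (ker_sum V j k) (ker_diff V j k)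
      (j e - k e) = (p, q, 0)"
proof -
  note b' = ker_sum_ker_diff_comm[OF disjI1[OF b]] and c' = ker_sum_ker_diff_comm[OF disjI2[OF c]]
  have 0: "0 \<in> ker_sum V j k" "0 \<in> ker_diff V j k"
    unfolding ker_sum_def ker_diff_def by (auto simp: lin closed)
  have jb: "j b + k b = 0" and jc: "j c - k c = 0" using b c unfolding ker_sum_def ker_diff_def by auto
  have q: "comm a \<in> V" using a by (simp add: closed)
  have je: "j e = j (comm a) + j b + j c" and ke: "k e = k (comm a) + k b + k c"
    using linear_map_onD(2)[OF j_lin sub] linear_map_onD(2)[OF k_lin sub] q b'(1) c'(1) closed(1)
    unfolding e by metis+
  have "j (comm a) + k (comm a) = comm (- (j a + k a))"
    and "j (comm a) - k (comm a) = comm (- (j a - k a))"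
    using a by (simp_all add: lin closed jj kk)
  note comm_im = this
  have "j e + k e = (j (comm a) + k (comm a)) + (j b + k b) + (j c + k c)"
    unfolding je ke by (simp only: ac_simps)
  then have "j e + k e = comm (- (j a + k a)) + 0 + (j c + k c)" unfolding comm_im jb .
  moreover have "comm (- (j a + k a)) \<in> im_commutator V j k"
    unfolding im_commutator_def using a by (intro imageI) (simp add: closed)
  moreover have "j c + k c \<in> ker_diff V j k"
    unfolding ker_diff_def using c' by (simp add: lin closed jj kk)
  ultimately show "\<exists>p q. splitting_components (im_commutator V j k) (ker_sum V j k) (ker_diff V j k)
      (j e + k e) = (p, 0, q)"
    using splitting_components_eq 0 by blast
  have "j e - k e = (j (comm a) - k (comm a)) + (j b - k b) + (j c - k c)"
    unfolding je ke by simp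
  then have "j e - k e = comm (- (j a - k a)) + (j b - k b) + 0" unfolding comm_im jc .
  moreover have "comm (- (j a - k a)) \<in> im_commutator V j k"
    unfolding im_commutator_def using a by (intro imageI) (simp add: closed)
  moreover have "j b - k b \<in> ker_sum V j k"
    unfolding ker_sum_def using b' by (simp add: lin closed jj kk)
  ultimately show "\<exists>p q. splitting_components (im_commutator V j k) (ker_sum V j k) (ker_diff V j k)
      (j e - k e) = (p, q, 0)"
    using splitting_components_eq 0 by blast
qed

end

section \<open>Frames, sections and endomorphisms of a vector bundle\<close>

context vector_bundle
begin

abbreviation frame :: "('m \<Rightarrow> 'f \<Rightarrow> 'r) \<Rightarrow> 'm \<Rightarrow> 'r \<Rightarrow> 'f" where
  "frame \<tau> y \<equiv> inv_into (E y) (\<tau> y)"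

lemmas fibre_closed = subspace_add[OF fibre_subspace] subspace_diff[OF fibre_subspace]
  subspace_neg[OF fibre_subspace] subspace_scale[OF fibre_subspace] subspace_0[OF fibre_subspace]

lemma triv_props:
  assumes "(U, \<tau>) \<in> \<Phi>" "y \<in> U"
  shows "linear_map_on (E y) UNIV (\<tau> y)" "frame \<tau> y w \<in> E y" "\<tau> y (frame \<tau> y w) = w"
    and "e \<in> E y \<Longrightarrow> frame \<tau> y (\<tau> y e) = e" "linear (frame \<tau> y)" "inj (frame \<tau> y)"
    and "range (frame \<tau> y) = E y"
proof -
  have l: "linear_map_on (E y) UNIV (\<tau> y)" and b: "bij_betw (\<tau> y) (E y) UNIV"
    using triv_iso[OF assms] by auto
  note L = linear_map_onD[OF l fibre_subspace]
  have im: "\<tau> y ` E y = UNIV" and inj: "inj_on (\<tau> y) (E y)" using b by (auto simp: bij_betw_def)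
  show "linear_map_on (E y) UNIV (\<tau> y)" by fact
  show in_E: "frame \<tau> y w \<in> E y" for w using im by (intro inv_into_into) auto
  show \<tau>: "\<tau> y (frame \<tau> y w) = w" for w using im by (intro f_inv_into_f) auto
  show inv: "frame \<tau> y (\<tau> y e) = e" if "e \<in> E y" for e by (rule inv_into_f_f[OF inj that])
  show "linear (frame \<tau> y)"
  proof (rule linearI)
    fix w w' and c :: real
    have "\<tau> y (frame \<tau> y w + frame \<tau> y w') = w + w'" using L(2) in_E \<tau> by simp
    then show "frame \<tau> y (w + w') = frame \<tau> y w + frame \<tau> y w'"
      using inv[of "frame \<tau> y w + frame \<tau> y w'"] in_E fibre_closed by simp
    have "\<tau> y (c *\<^sub>R frame \<tau> y w) = c *\<^sub>R w" using L(3) in_E \<tau> by simp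
    then show "frame \<tau> y (c *\<^sub>R w) = c *\<^sub>R frame \<tau> y w"
      using inv[of "c *\<^sub>R frame \<tau> y w"] in_E fibre_closed by simp
  qed
  show "inj (frame \<tau> y)" using \<tau> by (metis injI)
  show "range (frame \<tau> y) = E y" using in_E inv by (metis image_subsetI rangeI subsetI subset_antisym)
qed

lemma frame_expansion:
  assumes "(U, \<tau>) \<in> \<Phi>" "y \<in> U"
  shows "frame \<tau> y w = (\<Sum>b\<in>Basis. (w \<bullet> b) *\<^sub>R frame \<tau> y b)"
  using arg_cong[OF euclidean_representation[of w], of "frame \<tau> y"] triv_props(5)[OF assms]
  by (simp only: linear_sum linear_cmul)

lemma smooth_sectionsI:
  assumes "\<And>y. s y \<in> E y" "\<And>V \<sigma>. (V, \<sigma>) \<in> \<Phi> \<Longrightarrow> smooth_map_on A V (\<lambda>y. \<sigma> y (s y))"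
  shows "s \<in> smooth_sections A E \<Phi>"
  using assms unfolding smooth_sections_def by auto

lemma smooth_sectionsD:
  assumes "s \<in> smooth_sections A E \<Phi>"
  shows "s y \<in> E y" "(V, \<sigma>) \<in> \<Phi> \<Longrightarrow> smooth_map_on A V (\<lambda>y. \<sigma> y (s y))"
  using assms unfolding smooth_sections_def by auto

lemma smooth_sections_zero: "(\<lambda>y. 0) \<in> smooth_sections A E \<Phi>"
proof (rule smooth_sectionsI)
  fix V \<sigma> assume v: "(V, \<sigma>) \<in> \<Phi>"
  have "\<sigma> y 0 = 0" if "y \<in> V" for y
    using linear_map_onD(4)[OF triv_props(1)[OF v that] fibre_subspace] .
  then show "smooth_map_on A V (\<lambda>y. \<sigma> y 0)"
    using smooth_map_on_cong[OF triv_open[OF v], of "\<lambda>y. \<sigma> y 0" "\<lambda>y. 0"]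
    by (simp add: smooth_map_on_const triv_open[OF v])
qed (simp add: fibre_closed)

lemma smooth_sections_add:
  assumes "s \<in> smooth_sections A E \<Phi>" "s' \<in> smooth_sections A E \<Phi>"
  shows "(\<lambda>y. s y + s' y) \<in> smooth_sections A E \<Phi>"
proof (rule smooth_sectionsI)
  fix V \<sigma> assume v: "(V, \<sigma>) \<in> \<Phi>"
  have "\<sigma> y (s y + s' y) = \<sigma> y (s y) + \<sigma> y (s' y)" if "y \<in> V" for y
    using linear_map_onD(2)[OF triv_props(1)[OF v that] fibre_subspace] assms smooth_sectionsD by simp
  then show "smooth_map_on A V (\<lambda>y. \<sigma> y (s y + s' y))"
    using smooth_map_on_cong[OF triv_open[OF v], of "\<lambda>y. \<sigma> y (s y + s' y)"
        "\<lambda>y. \<sigma> y (s y) + \<sigma> y (s' y)"]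
      smooth_map_on_add[OF triv_open[OF v] assms[THEN smooth_sectionsD(2), OF v]] by simp
qed (use assms smooth_sectionsD in \<open>auto intro!: fibre_closed\<close>)

lemma smooth_sections_scaleR:
  assumes "f \<in> smooth_functions A" "s \<in> smooth_sections A E \<Phi>"
  shows "(\<lambda>y. f y *\<^sub>R s y) \<in> smooth_sections A E \<Phi>"
proof (rule smooth_sectionsI)
  fix V \<sigma> assume v: "(V, \<sigma>) \<in> \<Phi>"
  have f: "smooth_map_on A V f"
    using assms(1) by (auto simp: smooth_functions_def intro: smooth_map_on_subset)
  have "\<sigma> y (f y *\<^sub>R s y) = f y *\<^sub>R \<sigma> y (s y)" if "y \<in> V" for y
    using linear_map_onD(3)[OF triv_props(1)[OF v that] fibre_subspace] assms smooth_sectionsD by simp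
  then show "smooth_map_on A V (\<lambda>y. \<sigma> y (f y *\<^sub>R s y))"
    using smooth_map_on_cong[OF triv_open[OF v], of "\<lambda>y. \<sigma> y (f y *\<^sub>R s y)"
        "\<lambda>y. f y *\<^sub>R \<sigma> y (s y)"]
      smooth_map_on_scaleR[OF triv_open[OF v] f smooth_sectionsD(2)[OF assms(2) v]] by simp
qed (use assms smooth_sectionsD in \<open>auto intro!: fibre_closed\<close>)

lemma smooth_sections_sum:
  assumes "finite B" "\<And>b. b \<in> B \<Longrightarrow> s b \<in> smooth_sections A E \<Phi>"
  shows "(\<lambda>y. \<Sum>b\<in>B. s b y) \<in> smooth_sections A E \<Phi>"
  using assms
  by (induction B rule: finite_induct) (auto intro: smooth_sections_zero smooth_sections_add)

lemma End_section_linear: "smooth_End_section A E \<Phi> L \<Longrightarrow> linear_map_on (E y) (E y) (L y)"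
  unfolding smooth_End_section_def by blast

lemma End_section_apply_smooth:
  assumes L: "smooth_End_section A E \<Phi> L" and s: "s \<in> smooth_sections A E \<Phi>"
  shows "(\<lambda>y. L y (s y)) \<in> smooth_sections A E \<Phi>"
proof (rule smooth_sectionsI)
  note lin = End_section_linear[OF L]
  show "L y (s y) \<in> E y" for y
    using linear_map_onD(1)[OF lin fibre_subspace] smooth_sectionsD(1)[OF s] .
  fix V \<sigma> assume v: "(V, \<sigma>) \<in> \<Phi>"
  have "\<sigma> y (L y (s y)) = (\<Sum>b\<in>Basis. (\<sigma> y (s y) \<bullet> b) *\<^sub>R \<sigma> y (L y (frame \<sigma> y b)))"
    if y: "y \<in> V" for y
  proof -
    note t = triv_props[OF v y]
    have "s y = (\<Sum>b\<in>Basis. (\<sigma> y (s y) \<bullet> b) *\<^sub>R frame \<sigma> y b)"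
      using frame_expansion[OF v y, of "\<sigma> y (s y)"] t(4)[OF smooth_sectionsD(1)[OF s]] by simp
    then have "L y (s y) = L y (\<Sum>b\<in>Basis. (\<sigma> y (s y) \<bullet> b) *\<^sub>R frame \<sigma> y b)"
      by (rule arg_cong)
    also have "\<dots> = (\<Sum>b\<in>Basis. (\<sigma> y (s y) \<bullet> b) *\<^sub>R L y (frame \<sigma> y b))"
      by (rule linear_map_on_sum[OF lin fibre_subspace finite_Basis t(2)])
    also have "\<sigma> y \<dots> = (\<Sum>b\<in>Basis. (\<sigma> y (s y) \<bullet> b) *\<^sub>R \<sigma> y (L y (frame \<sigma> y b)))"
      by (rule linear_map_on_sum[OF t(1) fibre_subspace finite_Basis
            linear_map_onD(1)[OF lin fibre_subspace t(2)]])
    finally show ?thesis .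
  qed
  note eq = this
  have "smooth_map_on A V (\<lambda>y. \<Sum>b\<in>Basis. (\<sigma> y (s y) \<bullet> b) *\<^sub>R \<sigma> y (L y (frame \<sigma> y b)))"
    using L v unfolding smooth_End_section_def
    by (intro smooth_map_on_sum smooth_map_on_scaleR smooth_map_on_inner_left triv_open[OF v]
        smooth_sectionsD(2)[OF s v] finite_Basis) auto
  then show "smooth_map_on A V (\<lambda>y. \<sigma> y (L y (s y)))"
    using smooth_map_on_cong[OF triv_open[OF v], of "\<lambda>y. \<sigma> y (L y (s y))"] eq by simp
qed

lemma cutoff_frame_smooth:
  assumes t: "(U, \<tau>) \<in> \<Phi>" and \<rho>: "cutoff \<rho> U"
  shows "(\<lambda>y. \<rho> y *\<^sub>R frame \<tau> y w) \<in> smooth_sections A E \<Phi>"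
proof (rule smooth_sectionsI)
  show in_E: "\<rho> y *\<^sub>R frame \<tau> y w \<in> E y" for y
    by (cases "y \<in> U") (simp_all add: triv_props(2)[OF t] fibre_closed cutoff_zero[OF \<rho>])
  fix V \<sigma> assume v: "(V, \<sigma>) \<in> \<Phi>"
  have eq: "\<sigma> y (\<rho> y *\<^sub>R frame \<tau> y w) = \<rho> y *\<^sub>R \<sigma> y (frame \<tau> y w)" if y: "y \<in> V" for y
    using linear_map_onD(3,4)[OF triv_props(1)[OF v y] fibre_subspace] triv_props(2)[OF t]
    by (cases "y \<in> U") (simp_all add: cutoff_zero[OF \<rho>])
  have "smooth_map_on A V (\<lambda>y. \<rho> y *\<^sub>R \<sigma> y (frame \<tau> y w))"
    using triv_transition[OF t v]
    by (intro cutoff_scaleR_smooth[OF \<rho>] triv_open[OF t] triv_open[OF v]) (simp add: Int_commute)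
  then show "smooth_map_on A V (\<lambda>y. \<sigma> y (\<rho> y *\<^sub>R frame \<tau> y w))"
    using smooth_map_on_cong[OF triv_open[OF v], of "\<lambda>y. \<sigma> y (\<rho> y *\<^sub>R frame \<tau> y w)"] eq by simp
qed

lemma cutoff_coordinate_smooth:
  assumes t: "(U, \<tau>) \<in> \<Phi>" and \<rho>: "cutoff \<rho> U" and s: "s \<in> smooth_sections A E \<Phi>"
  shows "(\<lambda>y. \<rho> y * (\<tau> y (s y) \<bullet> b)) \<in> smooth_functions A"
  using cutoff_scaleR_smooth[OF \<rho> triv_open[OF t] open_UNIV, of "\<lambda>y. \<tau> y (s y) \<bullet> b"]
    smooth_map_on_inner_left[OF triv_open[OF t] smooth_sectionsD(2)[OF s t]]
  by (simp add: smooth_functions_def)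

text \<open>Two factors \<open>\<rho>\<close> are needed: one makes the coordinates of \<open>s\<close> global functions, the other makes
  the local frame global sections.\<close>

lemma cutoff_section_expansion:
  assumes t: "(U, \<tau>) \<in> \<Phi>" and \<rho>: "cutoff \<rho> U" and s: "s \<in> smooth_sections A E \<Phi>"
  shows "(\<rho> y * \<rho> y) *\<^sub>R s y =
    (\<Sum>b\<in>Basis. (\<rho> y * (\<tau> y (s y) \<bullet> b)) *\<^sub>R (\<rho> y *\<^sub>R frame \<tau> y b))"
proof (cases "y \<in> U")
  case True
  have "s y = (\<Sum>b\<in>Basis. (\<tau> y (s y) \<bullet> b) *\<^sub>R frame \<tau> y b)"
    using frame_expansion[OF t True, of "\<tau> y (s y)"] triv_props(4)[OF t True smooth_sectionsD(1)[OF s]]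
    by simp
  then have "(\<rho> y * \<rho> y) *\<^sub>R s y = (\<rho> y * \<rho> y) *\<^sub>R (\<Sum>b\<in>Basis. (\<tau> y (s y) \<bullet> b) *\<^sub>R frame \<tau> y b)"
    by (rule arg_cong)
  then show ?thesis by (simp add: scaleR_sum_right mult.assoc mult.commute mult.left_commute)
qed (simp add: cutoff_zero[OF \<rho>])

lemma section_through:
  assumes "e \<in> E x"
  obtains s where "s \<in> smooth_sections A E \<Phi>" "s x = e"
proof -
  obtain U \<tau> where t: "(U, \<tau>) \<in> \<Phi>" "x \<in> U" using triv_cover by blast
  obtain \<rho> where \<rho>: "cutoff \<rho> U" "\<rho> x = 1" using cutoff_exists[OF triv_open[OF t(1)] t(2)] .
  show ?thesis
    using that[OF cutoff_frame_smooth[OF t(1) \<rho>(1), of "\<tau> x e"]] triv_props(4)[OF t assms] \<rho>(2) by simp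
qed

text \<open>An operator that is linear over smooth functions only sees the value of a section at \<open>x\<close>:
  multiplying \<open>s\<close> by \<open>\<rho>\<^sup>2\<close> with \<open>\<rho> x = 1\<close> does not change \<open>D s\<close>, and \<open>\<rho>\<^sup>2 s\<close> is a combination of
  global sections, the cut-off frame, with smooth global coefficients.\<close>

lemma tensorial:
  fixes D :: "('m \<Rightarrow> 'f) \<Rightarrow> 'f"
  assumes add: "\<And>s s'. s \<in> smooth_sections A E \<Phi> \<Longrightarrow> s' \<in> smooth_sections A E \<Phi> \<Longrightarrow>
      D (\<lambda>y. s y + s' y) = D s + D s'"
    and scale: "\<And>f s. f \<in> smooth_functions A \<Longrightarrow> s \<in> smooth_sections A E \<Phi> \<Longrightarrow>
      D (\<lambda>y. f y *\<^sub>R s y) = f x *\<^sub>R D s"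
    and s: "s \<in> smooth_sections A E \<Phi>" "s' \<in> smooth_sections A E \<Phi>" "s x = s' x"
  shows "D s = D s'"
proof -
  obtain U \<tau> where t: "(U, \<tau>) \<in> \<Phi>" "x \<in> U" using triv_cover by blast
  obtain \<rho> where \<rho>: "cutoff \<rho> U" "\<rho> x = 1" using cutoff_exists[OF triv_open[OF t(1)] t(2)] .
  have \<rho>s: "\<rho> \<in> smooth_functions A" using \<rho>(1) unfolding cutoff_def by blast
  have sum: "D (\<lambda>y. \<Sum>b\<in>B. r b y) = (\<Sum>b\<in>B. D (r b))"
    if "finite B" "\<And>b. b \<in> B \<Longrightarrow> r b \<in> smooth_sections A E \<Phi>" for B :: "'r set" and r
    using that
  proof (induction B rule: finite_induct)
    case empty
    show ?case using scale[OF smooth_functions_const[of 0] smooth_sections_zero] by simp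
  next
    case (insert b B)
    then show ?case using add[of "r b" "\<lambda>y. \<Sum>b\<in>B. r b y"] smooth_sections_sum by auto
  qed
  have "D s = (\<Sum>b\<in>Basis. (\<tau> x (s x) \<bullet> b) *\<^sub>R D (\<lambda>y. \<rho> y *\<^sub>R frame \<tau> y b))"
    if s: "s \<in> smooth_sections A E \<Phi>" for s
  proof -
    note coord = cutoff_coordinate_smooth[OF t(1) \<rho>(1) s]
    note frame = cutoff_frame_smooth[OF t(1) \<rho>(1)]
    have "D s = D (\<lambda>y. (\<rho> y * \<rho> y) *\<^sub>R s y)"
      using scale[OF smooth_functions_mult[OF \<rho>s \<rho>s] s] \<rho>(2) by simp
    also have "\<dots> = D (\<lambda>y. \<Sum>b\<in>Basis. (\<rho> y * (\<tau> y (s y) \<bullet> b)) *\<^sub>R (\<rho> y *\<^sub>R frame \<tau> y b))"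
      by (simp only: cutoff_section_expansion[OF t(1) \<rho>(1) s])
    also have "\<dots> = (\<Sum>b\<in>Basis. D (\<lambda>y. (\<rho> y * (\<tau> y (s y) \<bullet> b)) *\<^sub>R (\<rho> y *\<^sub>R frame \<tau> y b)))"
      by (intro sum smooth_sections_scaleR coord frame finite_Basis)
    also have "\<dots> = (\<Sum>b\<in>Basis. (\<tau> x (s x) \<bullet> b) *\<^sub>R D (\<lambda>y. \<rho> y *\<^sub>R frame \<tau> y b))"
      by (rule sum.cong[OF refl]) (use scale[OF coord frame] \<rho>(2) in simp)
    finally show ?thesis .
  qed
  then show ?thesis using s by simp
qed

text \<open>The frame, as an injective linear map onto the fibre, carries the kernel of the local
  representative onto the kernel of \<open>l\<close>.\<close>

lemma dim_End_kernel:
  assumes t: "(U, \<tau>) \<in> \<Phi>" "y \<in> U" and L: "linear_map_on (E y) (E y) l"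
  shows "linear (\<lambda>w. \<tau> y (l (frame \<tau> y w)))"
    and "dim (range (\<lambda>w. \<tau> y (l (frame \<tau> y w)))) + dim {e \<in> E y. l e = 0} = DIM('r)"
proof -
  note tp = triv_props[OF t]
  note l = linear_map_onD[OF L fibre_subspace] and \<tau> = linear_map_onD[OF tp(1) fibre_subspace]
  let ?F = "\<lambda>w. \<tau> y (l (frame \<tau> y w))"
  show F: "linear ?F"
    by (rule linearI) (simp_all add: linear_add[OF tp(5)] linear_cmul[OF tp(5)] l \<tau> tp(2))
  have "?F w = 0 \<longleftrightarrow> l (frame \<tau> y w) = 0" for w
    using tp(4)[OF l(1)[OF tp(2)]] \<tau>(4) linear_0[OF tp(5)] by metis
  then have "frame \<tau> y ` {w. ?F w = 0} = {e \<in> range (frame \<tau> y). l e = 0}" by auto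
  then have "frame \<tau> y ` {w. ?F w = 0} = {e \<in> E y. l e = 0}" unfolding tp(7) .
  moreover have "dim (frame \<tau> y ` {w. ?F w = 0}) = dim {w. ?F w = 0}"
    using tp(5,6) by (intro dim_image_eq) (auto intro: inj_on_subset)
  ultimately show "dim (range ?F) + dim {e \<in> E y. l e = 0} = DIM('r)"
    using dim_range_eq_codim_kernel[OF F] by simp
qed

lemma End_section_pencil:
  assumes J: "smooth_End_section A E \<Phi> J" and K: "smooth_End_section A E \<Phi> K"
  shows "smooth_End_section A E \<Phi> (\<lambda>y e. J y e + c *\<^sub>R K y e)"
  unfolding smooth_End_section_def
proof (intro conjI allI ballI, goal_cases)
  case (1 y)
  show ?case
    using End_section_linear[OF J, of y] End_section_linear[OF K, of y]
    unfolding linear_map_on_def by (auto intro!: fibre_closed simp: scaleR_add_right mult.commute)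
next
  case (2 U\<tau>)
  show ?case
  proof (cases U\<tau>)
    case (Pair U \<tau>)
    then have t: "(U, \<tau>) \<in> \<Phi>" using 2 by simp
    have "smooth_map_on A U (\<lambda>y. \<tau> y (J y (frame \<tau> y w) + c *\<^sub>R K y (frame \<tau> y w)))" for w
    proof -
      have eq: "\<tau> y (J y (frame \<tau> y w) + c *\<^sub>R K y (frame \<tau> y w)) =
          \<tau> y (J y (frame \<tau> y w)) + c *\<^sub>R \<tau> y (K y (frame \<tau> y w))" if y: "y \<in> U" for y
        using triv_props(2)[OF t y] linear_map_onD(2,3)[OF triv_props(1)[OF t y] fibre_subspace]
          linear_map_onD(1)[OF End_section_linear[OF J] fibre_subspace]
          linear_map_onD(1)[OF End_section_linear[OF K] fibre_subspace] fibre_closed by simp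
      have "smooth_map_on A U (\<lambda>y. \<tau> y (J y (frame \<tau> y w)) + c *\<^sub>R \<tau> y (K y (frame \<tau> y w)))"
        using J K t unfolding smooth_End_section_def
        by (intro smooth_map_on_add smooth_map_on_scaleR smooth_map_on_const triv_open[OF t]) auto
      then show ?thesis
        using smooth_map_on_cong[OF triv_open[OF t],
            of "\<lambda>y. \<tau> y (J y (frame \<tau> y w) + c *\<^sub>R K y (frame \<tau> y w))"] eq by simp
    qed
    then show ?thesis using Pair by simp
  qed
qed

text \<open>In a trivialization this is \<open>index_le_one_imp_image_eq\<close>.\<close>

lemma fibre_index_le_one:
  assumes l: "linear_map_on (E x) (E x) l" and idx: "\<And>a. a \<in> E x \<Longrightarrow> l (l a) = 0 \<Longrightarrow> l a = 0"
    and e: "e \<in> E x"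
  obtains a where "a \<in> E x" "l e = l (l a)"
proof -
  obtain U \<tau> where t: "(U, \<tau>) \<in> \<Phi>" "x \<in> U" using triv_cover by blast
  note tp = triv_props[OF t] and lE = linear_map_onD(1)[OF l fibre_subspace]
  note \<tau>0 = linear_map_onD(4)[OF tp(1) fibre_subspace]
  let ?C = "\<lambda>w. \<tau> x (l (frame \<tau> x w))"
  have "?C w = 0" if "?C (?C w) = 0" for w
  proof -
    have "\<tau> x (l (l (frame \<tau> x w))) = 0" using that tp(4)[OF lE[OF tp(2)]] by simp
    then have "l (l (frame \<tau> x w)) = frame \<tau> x 0"
      using tp(4)[OF lE[OF lE[OF tp(2)]]] by metis
    then have "l (frame \<tau> x w) = 0" using idx tp(2) linear_0[OF tp(5)] by simp
    then show ?thesis using \<tau>0 by simp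
  qed
  then obtain w where "?C (\<tau> x e) = ?C (?C w)"
    using index_le_one_imp_image_eq[OF dim_End_kernel(1)[OF t l]] by blast
  then have "\<tau> x (l e) = \<tau> x (l (l (frame \<tau> x w)))"
    using tp(4)[OF e] tp(4)[OF lE[OF tp(2)]] by simp
  then have "l e = l (l (frame \<tau> x w))" using tp(4) lE e tp(2) by metis
  then show ?thesis using that tp(2) by blast
qed

end

section \<open>Covariant derivatives of endomorphisms along a curve\<close>

context bundle_connection
begin

text \<open>The terms with derivatives of \<open>f\<close> cancel in \<open>\<nabla>\<^sub>v (L (f s)) - L (\<nabla>\<^sub>v (f s))\<close>, so the expression is
  tensorial in \<open>s\<close>; the definite description in the definition of \<open>\<nabla>\<^sub>v L\<close> therefore denotes.\<close>

lemma nabla_End_eq: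
  assumes v: "v \<in> tangent_space A x" and L: "smooth_End_section A E \<Phi> L"
    and s: "s \<in> smooth_sections A E \<Phi>"
  shows "nabla_End A E \<Phi> nabla x v L (s x) = nabla x v (\<lambda>y. L y (s y)) - L x (nabla x v s)"
proof -
  let ?D = "\<lambda>s. nabla x v (\<lambda>y. L y (s y)) - L x (nabla x v s)"
  note LE = End_section_apply_smooth[OF L]
  note lin = linear_map_onD[OF End_section_linear[OF L] fibre_subspace]
  have add: "?D (\<lambda>y. r y + r' y) = ?D r + ?D r'"
    if r: "r \<in> smooth_sections A E \<Phi>" "r' \<in> smooth_sections A E \<Phi>" for r r'
  proof -
    have "(\<lambda>y. L y (r y + r' y)) = (\<lambda>y. L y (r y) + L y (r' y))"
      using lin(2) r smooth_sectionsD(1) by blast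
    then show ?thesis
      using nabla_add[OF v LE[OF r(1)] LE[OF r(2)]] nabla_add[OF v r]
      by (simp add: lin(2) nabla_fibre[OF v] r)
  qed
  have scale: "?D (\<lambda>y. f y *\<^sub>R r y) = f x *\<^sub>R ?D r"
    if f: "f \<in> smooth_functions A" and r: "r \<in> smooth_sections A E \<Phi>" for f r
  proof -
    have "(\<lambda>y. L y (f y *\<^sub>R r y)) = (\<lambda>y. f y *\<^sub>R L y (r y))"
      using lin(3) smooth_sectionsD(1)[OF r] by blast
    then show ?thesis
      using nabla_Leibniz[OF v f LE[OF r]] nabla_Leibniz[OF v f r]
      by (simp add: lin(2,3) nabla_fibre[OF v] r fibre_closed smooth_sectionsD(1)[OF r] scaleR_diff_right)
  qed
  show ?thesis
    unfolding nabla_End_def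
  proof (rule the_equality)
    show "\<forall>s'\<in>smooth_sections A E \<Phi>. s' x = s x \<longrightarrow> ?D s = ?D s'"
      using tensorial[of ?D, OF add scale s] by metis
  qed (use s in blast)
qed

text \<open>The covariant derivative at a zero of a section does not depend on the connection: when
  \<open>\<nabla>\<^sub>v\<close> is applied to \<open>\<rho>\<^sup>2 s\<close> in a frame, the terms with the derivative of the frame carry the
  coordinates of \<open>s x = 0\<close> as factors.\<close>

lemma nabla_at_zero:
  assumes v: "v \<in> tangent_space A x" and t: "(U, \<tau>) \<in> \<Phi>" and \<rho>: "cutoff \<rho> U" "\<rho> x = 1"
    and x: "x \<in> U" and s: "s \<in> smooth_sections A E \<Phi>" "s x = 0"
  shows "nabla x v s = frame \<tau> x (\<Sum>b\<in>Basis. v (\<lambda>y. \<rho> y * (\<tau> y (s y) \<bullet> b)) *\<^sub>R b)"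
proof -
  note coord = cutoff_coordinate_smooth[OF t \<rho>(1) s(1)]
  note frame = cutoff_frame_smooth[OF t \<rho>(1)]
  have \<rho>s: "\<rho> \<in> smooth_functions A" using \<rho>(1) unfolding cutoff_def by blast
  have \<tau>0: "\<tau> x 0 = 0" using linear_map_onD(4)[OF triv_props(1)[OF t x] fibre_subspace] .
  have sum: "nabla x v (\<lambda>y. \<Sum>b\<in>B. r b y) = (\<Sum>b\<in>B. nabla x v (r b))"
    if "finite B" "\<And>b. b \<in> B \<Longrightarrow> r b \<in> smooth_sections A E \<Phi>" for B :: "'r set" and r
    using that
  proof (induction B rule: finite_induct)
    case empty
    show ?case using nabla_add[OF v smooth_sections_zero smooth_sections_zero] by simp
  next
    case (insert b B)
    then show ?case using nabla_add[OF v, of "r b" "\<lambda>y. \<Sum>b\<in>B. r b y"] smooth_sections_sum by auto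
  qed
  have "nabla x v s = nabla x v (\<lambda>y. (\<rho> y * \<rho> y) *\<^sub>R s y)"
    using nabla_Leibniz[OF v smooth_functions_mult[OF \<rho>s \<rho>s] s(1)] \<rho>(2) s(2) by simp
  also have "\<dots> = nabla x v (\<lambda>y. \<Sum>b\<in>Basis. (\<rho> y * (\<tau> y (s y) \<bullet> b)) *\<^sub>R (\<rho> y *\<^sub>R frame \<tau> y b))"
    by (simp only: cutoff_section_expansion[OF t \<rho>(1) s(1)])
  also have "\<dots> = (\<Sum>b\<in>Basis. nabla x v (\<lambda>y. (\<rho> y * (\<tau> y (s y) \<bullet> b)) *\<^sub>R (\<rho> y *\<^sub>R frame \<tau> y b)))"
    by (intro sum smooth_sections_scaleR coord frame finite_Basis)
  also have "\<dots> = (\<Sum>b\<in>Basis. v (\<lambda>y. \<rho> y * (\<tau> y (s y) \<bullet> b)) *\<^sub>R frame \<tau> x b)"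
    by (rule sum.cong[OF refl]) (use nabla_Leibniz[OF v coord frame] \<rho>(2) s(2) \<tau>0 in simp)
  also have "\<dots> = frame \<tau> x (\<Sum>b\<in>Basis. v (\<lambda>y. \<rho> y * (\<tau> y (s y) \<bullet> b)) *\<^sub>R b)"
    by (simp add: linear_sum[OF triv_props(5)[OF t x]] linear_cmul[OF triv_props(5)[OF t x]])
  finally show ?thesis .
qed

text \<open>The cutoff leaves no trace, since its derivative is multiplied by \<open>s (\<gamma> u0) = 0\<close>.\<close>

lemma nabla_velocity_at_zero:
  assumes c: "open I" "u0 \<in> I" "smooth_curve_on A I \<gamma>" and t: "(U, \<tau>) \<in> \<Phi>" "\<gamma> u0 \<in> U"
    and s: "s \<in> smooth_sections A E \<Phi>" "s (\<gamma> u0) = 0"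
    and z: "((\<lambda>u. \<tau> (\<gamma> u) (s (\<gamma> u))) has_vector_derivative z') (at u0)"
  shows "nabla (\<gamma> u0) (velocity A \<gamma> u0) s = frame \<tau> (\<gamma> u0) z'"
proof -
  obtain \<rho> where \<rho>: "cutoff \<rho> U" "\<rho> (\<gamma> u0) = 1" using cutoff_exists[OF triv_open[OF t(1)] t(2)] .
  have \<rho>s: "smooth_map_on A UNIV \<rho>" using \<rho>(1) unfolding cutoff_def smooth_functions_def by blast
  obtain r' where r': "((\<rho> \<circ> \<gamma>) has_real_derivative r') (at u0)"
    using smooth_along_curve_differentiable[OF c open_UNIV UNIV_I \<rho>s] real_differentiable_def by blast
  have \<tau>0: "\<tau> (\<gamma> u0) 0 = 0" using linear_map_onD(4)[OF triv_props(1)[OF t] fibre_subspace] .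
  have "velocity A \<gamma> u0 (\<lambda>y. \<rho> y * (\<tau> y (s y) \<bullet> b)) = z' \<bullet> b" for b
  proof -
    have "((\<lambda>u. \<tau> (\<gamma> u) (s (\<gamma> u)) \<bullet> b) has_real_derivative z' \<bullet> b) (at u0)"
      using bounded_linear.has_vector_derivative[OF bounded_linear_inner_left z]
      by (simp add: has_real_derivative_iff_has_vector_derivative)
    from DERIV_mult[OF r' this] have "((\<lambda>u. \<rho> (\<gamma> u) * (\<tau> (\<gamma> u) (s (\<gamma> u)) \<bullet> b))
        has_real_derivative z' \<bullet> b) (at u0)"
      by (simp add: \<rho>(2) s(2) \<tau>0)
    then show ?thesis
      using cutoff_coordinate_smooth[OF t(1) \<rho>(1) s(1)]
      by (simp add: velocity_def comp_def DERIV_imp_deriv)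
  qed
  then show ?thesis
    using nabla_at_zero[OF velocity_in_tangent_space[OF c] t(1) \<rho> t(2) s] by (simp add: euclidean_representation)
qed

text \<open>Of \<open>\<nabla>\<^sub>v (L s) - L (\<nabla>\<^sub>v s)\<close> the second term lies in the image by its form, and the first one
  because the rank of \<open>L\<close> is constant along the curve.\<close>

lemma nabla_End_maps_kernel_to_image:
  assumes c: "open I" "0 \<in> I" "smooth_curve_on A I \<gamma>" and L: "smooth_End_section A E \<Phi> L"
    and dim: "\<forall>\<^sub>F u in nhds 0. dim {e \<in> E (\<gamma> u). L (\<gamma> u) e = 0} = d"
    and e: "e \<in> E (\<gamma> 0)" "L (\<gamma> 0) e = 0"
  shows "nabla_End A E \<Phi> nabla (\<gamma> 0) (velocity A \<gamma> 0) L e \<in> L (\<gamma> 0) ` E (\<gamma> 0)"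
proof -
  let ?x = "\<gamma> 0" and ?v = "velocity A \<gamma> 0"
  obtain U \<tau> where t: "(U, \<tau>) \<in> \<Phi>" and x: "?x \<in> U" using triv_cover by blast
  obtain s where s: "s \<in> smooth_sections A E \<Phi>" "s ?x = e" using section_through[OF e(1)] .
  note lin = linear_map_onD[OF End_section_linear[OF L] fibre_subspace]
  note Ls = End_section_apply_smooth[OF L s(1)]
  note v = velocity_in_tangent_space[OF c]
  \<comment> \<open>\<open>F u\<close> is the local representative of \<open>L\<close> at \<open>\<gamma> u\<close>, and \<open>z\<close> is that of the section \<open>L s\<close> along \<open>\<gamma>\<close>.\<close>
  define F where "F u w = \<tau> (\<gamma> u) (L (\<gamma> u) (frame \<tau> (\<gamma> u) w))" for u w
  define z where "z u = \<tau> (\<gamma> u) (L (\<gamma> u) (s (\<gamma> u)))" for u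
  have U: "\<forall>\<^sub>F u in nhds 0. \<gamma> u \<in> U"
    using curve_eventually_in[OF c triv_open[OF t] x] .
  have Fdim: "dim (range (F u)) + dim {e \<in> E (\<gamma> u). L (\<gamma> u) e = 0} = DIM('r)"
    and Flin: "linear (F u)" if "\<gamma> u \<in> U" for u
    using dim_End_kernel[OF t that End_section_linear[OF L]] unfolding F_def by auto
  have "(z has_vector_derivative vector_derivative z (at 0)) (at 0)"
    using smooth_along_curve_differentiable[OF c triv_open[OF t] x smooth_sectionsD(2)[OF Ls t]]
    by (simp add: z_def[abs_def] comp_def vector_derivative_works[symmetric])
  then obtain z' where z': "(z has_vector_derivative z') (at 0)" by blast
  have "z' \<in> range (F 0)"
  proof (rule derivative_in_range_of_constant_rank[OF _ _ _ z'])
    show "\<forall>\<^sub>F u in nhds 0. linear (F u)" using U by eventually_elim (rule Flin)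
    have d0: "dim {e \<in> E ?x. L ?x e = 0} = d" using eventually_nhds_x_imp_x[OF dim] .
    show "\<forall>\<^sub>F u in nhds 0. dim (range (F u)) \<le> dim (range (F 0))"
      using U dim by eventually_elim (use Fdim Fdim[OF x] d0 in fastforce)
    show "((\<lambda>u. F u w) \<longlongrightarrow> F 0 w) (at 0)" for w
    proof -
      have "smooth_map_on A U (\<lambda>y. \<tau> y (L y (frame \<tau> y w)))"
        using L t unfolding smooth_End_section_def by blast
      from smooth_along_curve_differentiable[OF c triv_open[OF t] x this]
      show ?thesis
        by (auto simp: F_def comp_def isCont_def dest!: differentiable_imp_continuous_within)
    qed
    show "z 0 = 0"
      using e(2) s(2) linear_map_onD(4)[OF triv_props(1)[OF t x] fibre_subspace] by (simp add: z_def)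
    show "\<forall>\<^sub>F u in nhds 0. z u \<in> range (F u)"
      using U
    proof eventually_elim
      case (elim u)
      show ?case
        unfolding z_def F_def using triv_props(4)[OF t elim smooth_sectionsD(1)[OF s(1)]]
        by (intro range_eqI[where x = "\<tau> (\<gamma> u) (s (\<gamma> u))"]) simp
    qed
  qed
  then obtain w where w: "z' = F 0 w" by blast
  have "nabla ?x ?v (\<lambda>y. L y (s y)) = frame \<tau> ?x z'"
    by (rule nabla_velocity_at_zero[OF c t x Ls _ z'[unfolded z_def]]) (simp add: s e)
  also have "\<dots> = L ?x (frame \<tau> ?x w)"
    using triv_props(4)[OF t x lin(1)[OF triv_props(2)[OF t x]]] by (simp add: w F_def)
  finally have "nabla_End A E \<Phi> nabla ?x ?v L e = L ?x (frame \<tau> ?x w - nabla ?x ?v s)"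
    using nabla_End_eq[OF v L s(1)] lin(6)[OF triv_props(2)[OF t x] nabla_fibre[OF v s(1)]] s(2)
    by simp
  then show ?thesis
    using fibre_closed(2)[OF triv_props(2)[OF t x] nabla_fibre[OF v s(1)]] by blast
qed

lemma nabla_End_pencil:
  assumes v: "v \<in> tangent_space A x" and J: "smooth_End_section A E \<Phi> J"
    and K: "smooth_End_section A E \<Phi> K" and e: "e \<in> E x"
  shows "nabla_End A E \<Phi> nabla x v (\<lambda>y e. J y e + c *\<^sub>R K y e) e =
    nabla_End A E \<Phi> nabla x v J e + c *\<^sub>R nabla_End A E \<Phi> nabla x v K e"
proof -
  obtain s where s: "s \<in> smooth_sections A E \<Phi>" "s x = e" using section_through[OF e] .
  note Js = End_section_apply_smooth[OF J s(1)] and Ks = End_section_apply_smooth[OF K s(1)]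
  have "nabla x v (\<lambda>y. J y (s y) + c *\<^sub>R K y (s y)) =
      nabla x v (\<lambda>y. J y (s y)) + c *\<^sub>R nabla x v (\<lambda>y. K y (s y))"
    using nabla_add[OF v Js smooth_sections_scaleR[OF smooth_functions_const Ks]]
      nabla_Leibniz[OF v smooth_functions_const Ks] tangent_const[OF v] by simp
  note sum = this
  show ?thesis
    unfolding s(2)[symmetric] nabla_End_eq[OF v J s(1)] nabla_End_eq[OF v K s(1)]
      nabla_End_eq[OF v End_section_pencil[OF J K, of c] s(1)] sum
    by (simp add: algebra_simps)
qed

text \<open>The cases \<open>r = 1\<close> and \<open>r = -1\<close> treat \<open>J + K\<close> and \<open>J - K\<close> together.\<close>

lemma nabla_End_kernel_pencil:
  assumes c: "open I" "0 \<in> I" "smooth_curve_on A I \<gamma>"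
    and J: "smooth_End_section A E \<Phi> J" and K: "smooth_End_section A E \<Phi> K"
    and par: "parallel_End A E \<Phi> nabla J" and r: "r \<noteq> 0"
    and dim: "\<forall>\<^sub>F u in nhds 0. dim {e \<in> E (\<gamma> u). J (\<gamma> u) e + r *\<^sub>R K (\<gamma> u) e = 0} = d"
    and e: "e \<in> E (\<gamma> 0)" "J (\<gamma> 0) e + r *\<^sub>R K (\<gamma> 0) e = 0"
  obtains b where "b \<in> E (\<gamma> 0)"
    "nabla_End A E \<Phi> nabla (\<gamma> 0) (velocity A \<gamma> 0) K e = J (\<gamma> 0) b + r *\<^sub>R K (\<gamma> 0) b"
proof -
  let ?L = "\<lambda>y e. J y e + r *\<^sub>R K y e"
  let ?N = "nabla_End A E \<Phi> nabla (\<gamma> 0) (velocity A \<gamma> 0)"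
  note v = velocity_in_tangent_space[OF c] and L = End_section_pencil[OF J K, of r]
  obtain b where b: "b \<in> E (\<gamma> 0)" "?N ?L e = ?L (\<gamma> 0) b"
    using nabla_End_maps_kernel_to_image[OF c L dim e] by blast
  have "?N J e = 0" using par v e(1) unfolding parallel_End_def by blast
  then have "r *\<^sub>R ?N K e = ?L (\<gamma> 0) b" using nabla_End_pencil[OF v J K e(1), of r] b(2) by simp
  then have "?N K e = (1 / r) *\<^sub>R ?L (\<gamma> 0) b" using r by (metis scaleR_scaleR scaleR_one nonzero_eq_divide_eq)
  also have "\<dots> = ?L (\<gamma> 0) ((1 / r) *\<^sub>R b)"
    using linear_map_onD(3)[OF End_section_linear[OF L] fibre_subspace b(1), of "1 / r"] by simp
  finally show ?thesis using that fibre_closed(4)[OF b(1)] by blast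
qed

end

section \<open>Vanishing of the diagonal blocks\<close>

theorem proposition7p11:
  fixes A :: "('m::{t2_space, second_countable_topology} set \<times> ('m \<Rightarrow> 'k::euclidean_space)) set"
    and E :: "'m \<Rightarrow> 'f::real_vector set"
    and \<Phi> :: "('m set \<times> ('m \<Rightarrow> 'f \<Rightarrow> 'r::euclidean_space)) set"
    and g :: "'m \<Rightarrow> 'f \<Rightarrow> 'f \<Rightarrow> real"
    and nabla :: "'m \<Rightarrow> (('m \<Rightarrow> real) \<Rightarrow> real) \<Rightarrow> ('m \<Rightarrow> 'f) \<Rightarrow> 'f"
    and J K :: "'m \<Rightarrow> 'f \<Rightarrow> 'f"
    and Msharp :: "'m set" and x :: 'm
    and v :: "('m \<Rightarrow> real) \<Rightarrow> real"
    and P0 P1 Pm1 :: "'f \<Rightarrow> 'f"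
    and I :: "real set" and \<gamma> :: "real \<Rightarrow> 'm"
    and n m1 mm1 :: nat
  assumes "vector_bundle A E \<Phi>" and "DIM('r) = 2 * n"
    and "bundle_connection A E \<Phi> nabla"
    and "bundle_metric A E \<Phi> g"
    and "twistor_section A E \<Phi> g J" and "twistor_section A E \<Phi> g K"
    and "parallel_End A E \<Phi> nabla J"
    and "Msharp = M_plus E J K m1 \<or> Msharp = M_minus E J K mm1 \<or>
         Msharp = M_plus E J K m1 \<inter> M_minus E J K mm1"
    and "x \<in> Msharp"
    and "\<And>e. e \<in> E x \<Longrightarrow> (P0 e, P1 e, Pm1 e) =
           splitting_components (im_commutator (E x) (J x) (K x))
             (ker_sum (E x) (J x) (K x)) (ker_diff (E x) (J x) (K x)) e"
    and "open I" and "is_interval I" and "0 \<in> I" and "smooth_curve_on A I \<gamma>"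
    and "\<gamma> 0 = x" and "\<forall>\<^sub>F t in nhds 0. \<gamma> t \<in> Msharp" and "velocity A \<gamma> 0 = v"
  shows "(Msharp = M_plus E J K m1 \<longrightarrow>
            (\<forall>e\<in>E x. P1 (nabla_End A E \<Phi> nabla x v K (P1 e)) = 0)) \<and>
         (Msharp = M_minus E J K mm1 \<longrightarrow>
            (\<forall>e\<in>E x. Pm1 (nabla_End A E \<Phi> nabla x v K (Pm1 e)) = 0)) \<and>
         (Msharp = M_plus E J K m1 \<inter> M_minus E J K mm1 \<longrightarrow>
            (\<forall>e\<in>E x. P1 (nabla_End A E \<Phi> nabla x v K (P1 e)) = 0) \<and>
            (\<forall>e\<in>E x. Pm1 (nabla_End A E \<Phi> nabla x v K (Pm1 e)) = 0))"
proof -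
  interpret bundle_connection A E \<Phi> nabla by fact
  interpret metric: bundle_metric A E \<Phi> g by fact
  have J: "smooth_End_section A E \<Phi> J" and K: "smooth_End_section A E \<Phi> K"
    and ocs: "J x \<in> orth_complex_structures (E x) (g x)" "K x \<in> orth_complex_structures (E x) (g x)"
    using assms(5,6) unfolding twistor_section_def by auto
  interpret fibre: orthogonal_pair "E x" "g x" "J x" "K x"
    using fibre_subspace metric.metric_linear metric.metric_sym metric.metric_pos ocs
    by unfold_locales auto
  let ?S = "splitting_components (im_commutator (E x) (J x) (K x))
      (ker_sum (E x) (J x) (K x)) (ker_diff (E x) (J x) (K x))"
  let ?N = "nabla_End A E \<Phi> nabla x v K"
  note curve = assms(11,13,14)
  have P: "P1 e = fst (snd (?S e))" "Pm1 e = snd (snd (?S e))" if "e \<in> E x" for e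
    using assms(10)[OF that, symmetric] by simp_all
  have split: "\<exists>a b c. a \<in> E x \<and> b \<in> ker_sum (E x) (J x) (K x) \<and> c \<in> ker_diff (E x) (J x) (K x) \<and>
      e = fibre.comm a + b + c" if "e \<in> E x" for e
    using fibre_index_le_one[OF fibre.comm_lin fibre.comm_inj_on_image that] fibre.splitting_exists[OF that]
    by metis
  have in_ker: "P1 e \<in> ker_sum (E x) (J x) (K x)" "Pm1 e \<in> ker_diff (E x) (J x) (K x)"
    if e: "e \<in> E x" for e
  proof -
    obtain a b c where *: "a \<in> E x" "b \<in> ker_sum (E x) (J x) (K x)" "c \<in> ker_diff (E x) (J x) (K x)"
      "e = fibre.comm a + b + c" using split[OF e] by blast
    have "fibre.comm a \<in> im_commutator (E x) (J x) (K x)"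
      unfolding im_commutator_def using *(1) by blast
    then have "?S e = (fibre.comm a, b, c)" using fibre.splitting_components_eq * by blast
    then show "P1 e \<in> ker_sum (E x) (J x) (K x)" "Pm1 e \<in> ker_diff (E x) (J x) (K x)"
      using P[OF e] * by simp_all
  qed
  \<comment> \<open>Nothing in the image of \<open>J + K\<close> has a component in the kernel of \<open>J + K\<close>; likewise for \<open>J - K\<close>.\<close>
  have vanish: "P1 (J x b + K x b) = 0" "Pm1 (J x b - K x b) = 0" if b: "b \<in> E x" for b
    using split[OF b] fibre.image_components P fibre.closed b by (metis fst_conv snd_conv)+
  have plus: "P1 (?N (P1 e)) = 0" if "\<forall>\<^sub>F t in nhds 0. \<gamma> t \<in> M_plus E J K m1" "e \<in> E x" for e
  proof -
    have "\<forall>\<^sub>F u in nhds 0. dim {e \<in> E (\<gamma> u). J (\<gamma> u) e + 1 *\<^sub>R K (\<gamma> u) e = 0} = 2 * m1"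
      using that(1) by (simp add: M_plus_def ker_sum_def)
    moreover have "P1 e \<in> E (\<gamma> 0)" "J (\<gamma> 0) (P1 e) + 1 *\<^sub>R K (\<gamma> 0) (P1 e) = 0"
      using in_ker(1)[OF that(2)] by (auto simp: ker_sum_def assms(15))
    ultimately obtain b where "b \<in> E x" "?N (P1 e) = J x b + 1 *\<^sub>R K x b"
      using nabla_End_kernel_pencil[OF curve J K assms(7), of 1] assms(15,17) by auto
    then show ?thesis using vanish(1) by simp
  qed
  have minus: "Pm1 (?N (Pm1 e)) = 0" if "\<forall>\<^sub>F t in nhds 0. \<gamma> t \<in> M_minus E J K mm1" "e \<in> E x" for e
  proof -
    have "\<forall>\<^sub>F u in nhds 0. dim {e \<in> E (\<gamma> u). J (\<gamma> u) e + (-1) *\<^sub>R K (\<gamma> u) e = 0} = 2 * mm1"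
      using that(1) by (simp add: M_minus_def ker_diff_def)
    moreover have "Pm1 e \<in> E (\<gamma> 0)" "J (\<gamma> 0) (Pm1 e) + (-1) *\<^sub>R K (\<gamma> 0) (Pm1 e) = 0"
      using in_ker(2)[OF that(2)] by (auto simp: ker_diff_def assms(15))
    ultimately obtain b where "b \<in> E x" "?N (Pm1 e) = J x b + (-1) *\<^sub>R K x b"
      using nabla_End_kernel_pencil[OF curve J K assms(7), of "-1"] assms(15,17) by auto
    then show ?thesis using vanish(2) by simp
  qed
  show ?thesis
    using assms(16) plus minus by (auto simp: eventually_conj_iff)
qed

end
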